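(* The variance $\sigma_n^2$ of $Y_n$ satisfies \[ \sigma_n^2 \sim C_\sigma\, n^{-2} (\log_\kappa n)^3 \tilde{f}(n)^2\qquad(n\to\infty), \] where $C_\sigma := p/(2q)$.
   Context: Fix $0<p<1$, $q=1-p$, $\kappa=1/q$, $\log_\kappa x=\log x/\log\kappa$. The random variables $Y_n$ are defined in distribution by $Y_0=0$, $Y_1=1$ and \[ Y_n \stackrel{d}{=} Y_{n-1} + Y^*_{n-1-\mathrm{Binom}(n-1;p)}\qquad(n\ge2), \] where $Y_k^*$ is a copy of $Y_k$, $\mathrm{Binom}(n-1;p)$ is a binomial random variable with parameters $n-1$ and $p$, and $Y_{n-1}$, $(Y^*_k)_k$ and the binomial variable are independent. The mean $\mu_n=\mathbb{E}(Y_n)$ satisfies $\mu_0=0$, $\mu_1=1$, $\mu_n=\mu_{n-1}+\sum_{0\le k<n}\binom{n-1}{k}q^kp^{n-1-k}\mu_k$ for $n\ge2$, and $\tilde f(z)=e^{-z}\sum_{n\ge0}\mu_nz^n/n!$. *)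

theory Defs
  imports "HOL-Probability.Probability"
begin

text \<open>
  Law of \<open>Y\<^sub>n\<close>. Sampling \<open>y\<close>, then \<open>b\<close>, then (given \<open>b\<close>) \<open>y'\<close> from the law of \<open>Y\<^sub>k\<close> with
  \<open>k = n - 1 - b\<close> encodes the independence of \<open>Y\<^sub>n\<^sub>-\<^sub>1\<close>, the binomial variable and the
  family of copies; see \<open>Y_law_rec\<close> below for the version with an explicit independent family.
  Only meaningful for \<open>0 \<le> p \<le> 1\<close>; the truncated subtraction never truncates a sampled value
  since then \<open>b \<le> n - 1\<close> almost surely.
\<close>

fun Y_law :: "real \<Rightarrow> nat \<Rightarrow> nat pmf" where
  "Y_law p 0 = return_pmf 0"
| "Y_law p (Suc 0) = return_pmf 1"
| "Y_law p (Suc (Suc n)) =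
     bind_pmf (Y_law p (Suc n)) (\<lambda>y.
     bind_pmf (binomial_pmf (Suc n) p) (\<lambda>b.
     bind_pmf (Y_law p (Suc n - b)) (\<lambda>y'.
     return_pmf (y + y'))))"

lemma Y_law_rec:
  assumes "n \<ge> 2"
  shows "Y_law p n =
    map_pmf (\<lambda>(y, b, ystar). y + ystar (n - 1 - b))
      (pair_pmf (Y_law p (n - 1)) (pair_pmf (binomial_pmf (n - 1) p) (Pi_pmf {..<n} 0 (Y_law p))))"
proof -
  define m where "m = n - 2"
  with assms have n: "n = Suc (Suc m)"
    by linarith
  have *: "bind_pmf (Pi_pmf {..<n} 0 (Y_law p)) (\<lambda>ystar. return_pmf (y + ystar (Suc m - b)))
      = bind_pmf (Y_law p (Suc m - b)) (\<lambda>y'. return_pmf (y + y'))" for y b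
  proof -
    have "Y_law p (Suc m - b) = map_pmf (\<lambda>ystar. ystar (Suc m - b)) (Pi_pmf {..<n} 0 (Y_law p))"
      by (subst Pi_pmf_component) (auto simp: n)
    then show ?thesis
      by (simp only: bind_map_pmf)
  qed
  have "map_pmf (\<lambda>(y, b, ystar). y + ystar (n - 1 - b))
      (pair_pmf (Y_law p (n - 1)) (pair_pmf (binomial_pmf (n - 1) p) (Pi_pmf {..<n} 0 (Y_law p))))
    = bind_pmf (Y_law p (Suc m)) (\<lambda>y. bind_pmf (binomial_pmf (Suc m) p) (\<lambda>b.
        bind_pmf (Pi_pmf {..<n} 0 (Y_law p)) (\<lambda>ystar. return_pmf (y + ystar (Suc m - b)))))"
    by (simp only: pair_pmf_def map_pmf_def bind_assoc_pmf bind_return_pmf prod.case n diff_Suc_1)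
  also have "\<dots> = Y_law p n"
    by (simp only: *) (simp only: n Y_law.simps(3))
  finally show ?thesis by (rule sym)
qed

definition mean_Y :: "real \<Rightarrow> nat \<Rightarrow> real" where
  "mean_Y p n = measure_pmf.expectation (Y_law p n) real"

definition variance_Y :: "real \<Rightarrow> nat \<Rightarrow> real" where
  "variance_Y p n = measure_pmf.variance (Y_law p n) real"

definition poisson_gf :: "real \<Rightarrow> real \<Rightarrow> real" where
  "poisson_gf p z = exp (- z) * (\<Sum>n. mean_Y p n * z ^ n / fact n)"

end

theory Submission
  imports Defs "HOL-Real_Asymp.Real_Asymp"
begin

text \<open>
  Write \<open>m\<close> and \<open>V\<close> for the mean and the variance, \<open>d n = m (n + 1) - m n\<close>, \<open>B\<^sub>n\<close> for a binomial
  variable with parameters \<open>n\<close> and \<open>q\<close>, and \<open>L n\<close> for the logarithm of \<open>n\<close> to base \<open>\<kappa>\<close>. The random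
  index \<open>n - 1 - Binom(n - 1; p)\<close> has the law of \<open>B\<^bsub>n-1\<^esub>\<close>, so for \<open>n \<ge> 1\<close> the mean satisfies
  \<open>d n = E m(B\<^sub>n)\<close> and, by the law of total variance, \<open>V (n + 1) - V n = E V(B\<^sub>n) + T n\<close> with
  \<open>T n = Var m(B\<^sub>n)\<close>.

  The heart of the matter is the growth rate of the mean: \<open>d n / m n \<sim> L n / n\<close> (\<open>rho_equiv\<close>). Already
  the upper bounds behind it show that \<open>m\<close> and \<open>d\<close> hardly change over distances like \<open>n\<^bsup>2/3\<^esup>\<close>, the scale beyond which a binomial
  variable practically never deviates from its mean \<open>q n\<close>. Therefore \<open>d n \<sim> m(q n)\<close>
  (\<open>d_equiv\<close>), and \<open>m(B\<^sub>n)\<close> is nearly the affine function of \<open>B\<^sub>n\<close> with slope \<open>d(q n)\<close>, whence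
  \<open>T n \<sim> n p q d(q n)\<^sup>2\<close> (\<open>T_equiv\<close>). Two applications of the growth rate turn this into
  \<open>T n \<sim> (p / q) (L n / n) X n\<close> with \<open>X n = L(n)\<^sup>3 m(n)\<^sup>2 / n\<^sup>2\<close>. On the other hand \<open>X\<close> grows by a
  factor of about \<open>1 + 2 L n / n\<close>, almost entirely because of \<open>m\<^sup>2\<close>, so that
  \<open>X (n + 1) - X n \<sim> 2 (L n / n) X n\<close>. The recursive contribution \<open>E V(B\<^sub>n)\<close> is of smaller order:
  replacing \<open>n\<close> by \<open>q n\<close> shrinks \<open>X\<close> by a factor of order \<open>(L n / n)\<^sup>2\<close>. The increments of \<open>V\<close> are
  thus asymptotic to \<open>p / (2 q)\<close> times those of \<open>X\<close>, and the Stolz-Cesaro theorem gives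
  \<open>V \<sim> p / (2 q) X\<close> (\<open>V_over_X\<close>). Finally the Poisson transform of \<open>m\<close> at \<open>n\<close> is asymptotic to
  \<open>m n\<close> (\<open>poisson_gf_equiv\<close>), again because \<open>m\<close> is nearly constant on the scale \<open>\<surd>n\<close>.

  The growth rate is obtained by comparing the quotient \<open>h n = d n / m n\<close> with explicit barriers.
  Since \<open>d (n + 1) - d n = q E d(B\<^sub>n)\<close> and \<open>d n = E m(B\<^sub>n)\<close>, the relative growth of \<open>d\<close> is \<open>q\<close> times an
  average of \<open>h\<close> near \<open>q n\<close>. For \<open>\<rho> n = n h n\<close> this means, roughly, that \<open>\<rho>\<close> relaxes towards
  \<open>\<rho>(q n) + 1\<close>, and the logarithm to base \<open>\<kappa> = 1 / q\<close> solves \<open>\<rho>(n) = \<rho>(q n) + 1\<close>. The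
  upper barrier (\<open>d_le_H_sharp\<close>) needs only that \<open>m\<close> increases: a decreasing bound for
  \<open>h\<close> and the increasing function \<open>m\<close> are negatively correlated. The lower barrier
  (\<open>rho_lower_barrier\<close>) uses concentration of the binomial law, for which the upper barrier already
  supplies the needed control of \<open>m\<close>.
\<close>

section \<open>Real sequences\<close>

lemma asymp_equiv_by_relative_error:
  fixes f g :: "nat \<Rightarrow> real"
  assumes "\<And>\<epsilon>. 0 < \<epsilon> \<Longrightarrow> eventually (\<lambda>n. \<bar>f n - g n\<bar> \<le> \<epsilon> * \<bar>g n\<bar>) sequentially"
  shows "f \<sim>[sequentially] g"
  by (rule smallo_imp_asymp_equiv, rule landau_o.smallI) (use assms in simp)

lemma eventually_Suc: "eventually P sequentially \<Longrightarrow> eventually (\<lambda>n. P (Suc n)) sequentially"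
  by (rule eventually_compose_filterlim[OF _ filterlim_Suc])

lemma ln_difference_le:
  fixes \<phi> :: "nat \<Rightarrow> real"
  assumes "i \<le> j" and "\<And>l. i \<le> l \<Longrightarrow> \<bar>ln (\<phi> (Suc l)) - ln (\<phi> l)\<bar> \<le> B"
  shows "\<bar>ln (\<phi> j) - ln (\<phi> i)\<bar> \<le> (real j - real i) * B"
  using assms(1)
proof (induction j rule: dec_induct)
  case (step n)
  then show ?case
    using assms(2)[of n] by (simp add: algebra_simps)
qed simp

text \<open>
  The increments of \<open>f - c g\<close> are eventually at most a small multiple of those of \<open>g\<close>, so they
  add up to a small multiple of \<open>g\<close>; the fixed initial error is swamped because \<open>g\<close> diverges.
\<close>

lemma Stolz_Cesaro:
  fixes f g :: "nat \<Rightarrow> real"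
  assumes g: "filterlim g at_top sequentially"
    and incr: "eventually (\<lambda>n. g n < g (Suc n)) sequentially"
    and lim: "(\<lambda>n. (f (Suc n) - f n) / (g (Suc n) - g n)) \<longlonglongrightarrow> c"
  shows "(\<lambda>n. f n / g n) \<longlonglongrightarrow> c"
proof (rule LIMSEQ_I)
  fix \<epsilon> :: real assume \<epsilon>: "0 < \<epsilon>"
  have "eventually (\<lambda>n. \<bar>(f (Suc n) - f n) / (g (Suc n) - g n) - c\<bar> < \<epsilon> / 4) sequentially"
    using tendstoD[OF lim, of "\<epsilon> / 4"] \<epsilon> by (simp add: dist_real_def)
  then have "eventually (\<lambda>n. \<bar>(f (Suc n) - c * g (Suc n)) - (f n - c * g n)\<bar> \<le> \<epsilon> / 4 * (g (Suc n) - g n)) sequentially"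
    using incr
  proof eventually_elim
    case (elim n)
    let ?D = "g (Suc n) - g n"
    have "\<bar>(f (Suc n) - f n) / ?D - c\<bar> * ?D \<le> \<epsilon> / 4 * ?D"
      using elim by (intro mult_right_mono) auto
    also have "\<bar>(f (Suc n) - f n) / ?D - c\<bar> * ?D = \<bar>((f (Suc n) - f n) / ?D - c) * ?D\<bar>"
      using elim(2) by (simp add: abs_mult)
    also have "((f (Suc n) - f n) / ?D - c) * ?D = (f (Suc n) - f n) - c * ?D"
      using elim(2) by (subst left_diff_distrib) simp
    also have "\<dots> = (f (Suc n) - c * g (Suc n)) - (f n - c * g n)"
      by (simp add: algebra_simps)
    finally show ?case .
  qed
  then obtain N where N: "\<And>n. N \<le> n \<Longrightarrow>
      \<bar>(f (Suc n) - c * g (Suc n)) - (f n - c * g n)\<bar> \<le> \<epsilon> / 4 * (g (Suc n) - g n)"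
    unfolding eventually_sequentially by blast
  have tele: "\<bar>(f n - c * g n) - (f N - c * g N)\<bar> \<le> \<epsilon> / 4 * (g n - g N)" if "N \<le> n" for n
    using that
  proof (induction n rule: dec_induct)
    case (step n)
    have "\<epsilon> / 4 * (g (Suc n) - g N) = \<epsilon> / 4 * (g (Suc n) - g n) + \<epsilon> / 4 * (g n - g N)"
      by (simp only: distrib_left[symmetric]) simp
    then show ?case
      using step.IH N[OF step.hyps(1)] by linarith
  qed simp
  define K where "K = \<bar>f N - c * g N\<bar> + \<epsilon> / 4 * \<bar>g N\<bar>"
  have "eventually (\<lambda>n. max 1 (4 * K / \<epsilon>) \<le> g n) sequentially"
    using g unfolding filterlim_at_top by blast
  then have "eventually (\<lambda>n. \<bar>f n / g n - c\<bar> < \<epsilon>) sequentially"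
    using eventually_ge_at_top[of N]
  proof eventually_elim
    case (elim n)
    have gn: "0 < g n" "4 * K / \<epsilon> \<le> g n"
      using elim(1) by auto
    have K: "K \<le> \<epsilon> / 4 * g n"
      using gn(2) \<epsilon> by (simp add: field_simps)
    have "\<bar>f n - c * g n\<bar> \<le> \<bar>f N - c * g N\<bar> + \<epsilon> / 4 * (g n - g N)"
      using tele[OF elim(2)] by linarith
    also have "\<dots> \<le> K + \<epsilon> / 4 * g n"
    proof -
      have "\<epsilon> / 4 * (g n - g N) \<le> \<epsilon> / 4 * (g n + \<bar>g N\<bar>)"
        using \<epsilon> by (intro mult_left_mono) auto
      then show ?thesis
        by (simp add: K_def algebra_simps)
    qed
    also have "\<dots> < \<epsilon> * g n"
    proof -
      have "0 < \<epsilon> * g n"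
        using \<epsilon> gn by simp
      then show ?thesis
        using K by linarith
    qed
    finally have "\<bar>f n - c * g n\<bar> < \<epsilon> * g n" .
    moreover have "f n / g n - c = (f n - c * g n) / g n"
      using gn by (simp add: field_simps)
    ultimately show ?case
      using gn by (simp add: abs_divide divide_less_eq)
  qed
  then show "\<exists>no. \<forall>n\<ge>no. norm (f n / g n - c) < \<epsilon>"
    by (simp add: eventually_sequentially)
qed

text \<open>
  The map \<open>y \<mapsto> (a ln y - b) / y\<close> has its maximum where \<open>a ln y - b = a\<close> and decreases from there
  on; the last hypothesis says that \<open>x\<close> lies beyond the maximum.
\<close>

lemma log_over_linear_antimono:
  fixes a b x y :: real
  assumes "0 < a" "0 < x" "x \<le> y" "a \<le> a * ln x - b"
  shows "(a * ln y - b) / y \<le> (a * ln x - b) / x"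
proof -
  have "a * ln (y / x) \<le> a * (y / x - 1)"
    using assms by (intro mult_left_mono ln_le_minus_one) auto
  also have "\<dots> \<le> (a * ln x - b) * (y / x - 1)"
    using assms by (intro mult_right_mono) (auto simp: field_simps)
  finally have "a * (ln y - ln x) \<le> (a * ln x - b) * (y / x - 1)"
    using assms by (simp add: ln_div)
  then have "a * ln y - b \<le> (a * ln x - b) * (y / x)"
    by (simp add: algebra_simps)
  then show ?thesis
    using assms by (simp add: field_simps)
qed

text \<open>
  The numerical core of the lower bound for the growth rate. Here \<open>N\<close> is the current index, \<open>l\<close>
  is \<open>ln \<kappa>\<close>, \<open>g\<close> is the value at \<open>N\<close> of a barrier with slope \<open>a\<close> in \<open>ln N\<close>, and
  \<open>\<sigma>\<close> is a relative error. After multiplication by \<open>N (N + g)\<close> the claim becomes a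
  comparison of the terms linear in \<open>N\<close>: it needs \<open>g (1 - a l - \<sigma> g)\<close> to exceed \<open>a\<close> with room to
  spare, which is why \<open>a l < 1\<close> and a large barrier are required.
\<close>

lemma barrier_algebra:
  fixes N g a \<theta> \<sigma> l :: real
  assumes "0 < N" "0 < g" "0 < a" "0 < \<theta>" "0 \<le> \<sigma>" "0 \<le> l"
    and "a * l \<le> 1 - \<theta>" "\<sigma> * g \<le> \<theta> / 4" "4 * a \<le> \<theta> * g" "1 + a \<le> N * \<theta> / 2"
  shows "g + a / N \<le> (N + 1) * (1 + (1 - \<sigma>) * (g - a * l) / N) * (g / (N + g))"
proof -
  define \<tau> where "\<tau> = a * l + \<sigma> * g"
  have \<tau>: "\<tau> \<le> 1 - 3 * \<theta> / 4"
    using assms by (simp add: \<tau>_def)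
  have e: "g - \<tau> \<le> (1 - \<sigma>) * (g - a * l)"
    using assms by (simp add: \<tau>_def algebra_simps)
  have "g * (3 * \<theta> / 4) \<le> g * (1 - \<tau>)"
    using \<tau> assms by (intro mult_left_mono) auto
  then have "g * \<theta> / 2 \<le> g * (1 - \<tau>) - a"
    using assms(9) by (simp add: algebra_simps)
  then have 1: "N * (g * \<theta> / 2) \<le> N * (g * (1 - \<tau>) - a)"
    using assms by (intro mult_left_mono) auto
  have "g * (1 + a) \<le> g * (N * \<theta> / 2)"
    using assms by (intro mult_left_mono) auto
  moreover have "- (1 + a) \<le> g - \<tau> - a"
    using \<tau> assms by linarith
  then have "g * (- (1 + a)) \<le> g * (g - \<tau> - a)"
    using assms by (intro mult_left_mono) auto
  ultimately have "0 \<le> N * (g * (1 - \<tau>) - a) + g * (g - \<tau> - a)"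
    using 1 by (simp add: algebra_simps)
  then have "(g * N + a) * (N + g) \<le> (N + 1) * (N + (g - \<tau>)) * g"
    by (simp add: algebra_simps)
  also have "\<dots> \<le> (N + 1) * (N + (1 - \<sigma>) * (g - a * l)) * g"
    using e assms by (intro mult_left_mono mult_right_mono add_left_mono) auto
  finally have "(g * N + a) * (N + g) / (N * (N + g))
      \<le> (N + 1) * (N + (1 - \<sigma>) * (g - a * l)) * g / (N * (N + g))"
    using assms by (intro divide_right_mono) auto
  also have "(g * N + a) * (N + g) / (N * (N + g)) = g + a / N"
    using assms by (simp add: add_divide_distrib)
  also have "(N + 1) * (N + (1 - \<sigma>) * (g - a * l)) * g / (N * (N + g))
      = (N + 1) * (1 + (1 - \<sigma>) * (g - a * l) / N) * (g / (N + g))"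
  proof -
    have "(N + 1) * (N + E) * g / (N * (N + g)) = (N + 1) * ((N + E) / N) * (g / (N + g))" for E
      by simp
    moreover have "(N + E) / N = 1 + E / N" for E
      using assms by (simp add: add_divide_distrib)
    ultimately show ?thesis
      by (simp only:)
  qed
  finally show ?thesis .
qed

section \<open>Binomial averages and the moment recursions\<close>

text \<open>
  The index \<open>n - 1 - Binom(n - 1; p)\<close> counts the items that survive when each of \<open>n - 1\<close> items is
  deleted with probability \<open>p\<close>; it has a binomial law with success probability \<open>q\<close>.
\<close>

locale thinning =
  fixes p q :: real
  assumes p_pos: "0 < p" and p_less_1: "p < 1" and q_eq: "q = 1 - p"
begin

lemma q_pos: "0 < q" and q_less_1: "q < 1"
  using p_pos p_less_1 q_eq by auto

definition weight :: "nat \<Rightarrow> nat \<Rightarrow> real" where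
  "weight n k = real (n choose k) * q ^ k * p ^ (n - k)"

text \<open>
  The expectation of \<open>\<phi>(B\<^sub>n)\<close> for the binomial variable \<open>B\<^sub>n\<close>, as a finite sum so that all the
  exact identities below are finite algebra.
\<close>

definition avg :: "nat \<Rightarrow> (nat \<Rightarrow> real) \<Rightarrow> real" where
  "avg n \<phi> = (\<Sum>k\<le>n. weight n k * \<phi> k)"

lemma weight_nonneg: "0 \<le> weight n k"
  using p_pos q_pos by (simp add: weight_def)

lemma sum_weight: "(\<Sum>k\<le>n. weight n k) = 1"
proof -
  have "(\<Sum>k\<le>n. weight n k) = (q + p) ^ n"
    unfolding weight_def by (subst binomial_ring) simp
  then show ?thesis
    by (simp add: q_eq)
qed

lemma avg_const: "avg n (\<lambda>_. c) = c"
  using sum_weight[of n] by (simp add: avg_def sum_distrib_right[symmetric])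

lemma avg_add: "avg n (\<lambda>k. f k + g k) = avg n f + avg n g"
  by (simp add: avg_def algebra_simps sum.distrib)

lemma avg_diff: "avg n (\<lambda>k. f k - g k) = avg n f - avg n g"
  by (simp add: avg_def algebra_simps sum_subtractf)

lemma avg_cmult: "avg n (\<lambda>k. c * f k) = c * avg n f"
  by (simp add: avg_def sum_distrib_left algebra_simps)

lemma avg_mono: "(\<And>k. k \<le> n \<Longrightarrow> f k \<le> g k) \<Longrightarrow> avg n f \<le> avg n g"
  unfolding avg_def by (intro sum_mono mult_left_mono weight_nonneg) auto

lemma avg_nonneg: "(\<And>k. k \<le> n \<Longrightarrow> 0 \<le> f k) \<Longrightarrow> 0 \<le> avg n f"
  unfolding avg_def by (intro sum_nonneg mult_nonneg_nonneg weight_nonneg) auto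

lemma weight_Suc_0: "weight (Suc n) 0 = p * weight n 0"
  by (simp add: weight_def)

lemma weight_Suc_Suc: "weight (Suc n) (Suc k) = q * weight n k + p * weight n (Suc k)"
proof (cases "k < n")
  case True
  then have "p ^ (n - k) = p * p ^ (n - Suc k)"
    by (simp add: Suc_diff_Suc flip: power_Suc)
  then show ?thesis
    by (simp add: weight_def algebra_simps)
next
  case False
  then show ?thesis
    by (cases "k = n") (simp_all add: weight_def binomial_eq_0)
qed

lemma weight_beyond: "n < k \<Longrightarrow> weight n k = 0"
  by (simp add: weight_def binomial_eq_0)

lemma avg_Suc: "avg (Suc n) f = q * avg n (\<lambda>k. f (Suc k)) + p * avg n f"
proof -
  have "avg (Suc n) f = weight (Suc n) 0 * f 0 + (\<Sum>k\<le>n. weight (Suc n) (Suc k) * f (Suc k))"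
    unfolding avg_def by (subst sum.atMost_Suc_shift) simp
  also have "\<dots> = q * avg n (\<lambda>k. f (Suc k))
      + p * (weight n 0 * f 0 + (\<Sum>k\<le>n. weight n (Suc k) * f (Suc k)))"
    by (simp add: weight_Suc_0 weight_Suc_Suc avg_def algebra_simps sum.distrib sum_distrib_left)
  also have "weight n 0 * f 0 + (\<Sum>k\<le>n. weight n (Suc k) * f (Suc k)) = (\<Sum>k\<le>Suc n. weight n k * f k)"
    by (subst sum.atMost_Suc_shift) simp
  also have "\<dots> = avg n f"
    by (simp add: avg_def weight_beyond)
  finally show ?thesis .
qed

text \<open>
  One further trial raises the binomial variable by one with probability \<open>q\<close>. This identity
  transports difference operators through the averages.
\<close>

lemma avg_increment: "avg (Suc n) f - avg n f = q * avg n (\<lambda>k. f (Suc k) - f k)"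
proof -
  have p: "p = 1 - q"
    by (simp add: q_eq)
  show ?thesis
    unfolding avg_Suc avg_diff by (subst p) (simp add: algebra_simps)
qed

lemma avg_absorb: "avg n (\<lambda>k. real k * f k) = real n * q * avg (n - 1) (\<lambda>k. f (Suc k))"
proof (cases n)
  case 0
  then show ?thesis by (simp add: avg_def)
next
  case (Suc m)
  have *: "weight (Suc m) (Suc k) * real (Suc k) = real (Suc m) * q * weight m k" if "k \<le> m" for k
  proof -
    have "real (Suc k) * real (Suc m choose Suc k) = real (Suc m) * real (m choose k)"
      using Suc_times_binomial_eq[of m k] by (metis mult.commute of_nat_mult)
    then have "(real (Suc k) * real (Suc m choose Suc k)) * (q ^ Suc k * p ^ (m - k))
        = (real (Suc m) * real (m choose k)) * (q ^ Suc k * p ^ (m - k))"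
      by (simp only:)
    then show ?thesis
      by (simp add: weight_def mult_ac del: binomial_Suc_Suc of_nat_Suc)
  qed
  have "avg n (\<lambda>k. real k * f k) = (\<Sum>k\<le>m. (weight (Suc m) (Suc k) * real (Suc k)) * f (Suc k))"
    unfolding avg_def Suc by (subst sum.atMost_Suc_shift) (simp add: algebra_simps)
  also have "\<dots> = (\<Sum>k\<le>m. (real (Suc m) * q * weight m k) * f (Suc k))"
    using * by (intro sum.cong) auto
  finally show ?thesis
    by (simp add: Suc avg_def sum_distrib_left algebra_simps)
qed

definition m :: "nat \<Rightarrow> real" where "m = mean_Y p"
definition V :: "nat \<Rightarrow> real" where "V = variance_Y p"
text \<open>
  The variance of \<open>m(B\<^sub>n)\<close>, the toll of the variance recursion.
\<close>

definition T :: "nat \<Rightarrow> real" where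
  "T n = avg n (\<lambda>k. (m k)\<^sup>2) - (avg n m)\<^sup>2"

lemma finite_Y_law: "finite (set_pmf (Y_law p n))"
proof (induction n rule: less_induct)
  case (less n)
  consider "n = 0" | "n = 1" | k where "n = Suc (Suc k)"
    by (metis One_nat_def not0_implies_Suc)
  then show ?case
    using less by cases (auto simp: p_pos p_less_1)
qed

lemma integrable_Y_law: "integrable (measure_pmf (Y_law p n)) (f :: nat \<Rightarrow> real)"
  by (rule integrable_measure_pmf_finite[OF finite_Y_law])

text \<open>
  All laws involved have finite support, so the nested integrals are finite sums and integrability
  is never an issue. Reversing the order of summation turns deletions into survivors.
\<close>

lemma expectation_Y_law:
  "measure_pmf.expectation (Y_law p (Suc (Suc n))) (h :: nat \<Rightarrow> real) =
     measure_pmf.expectation (Y_law p (Suc n)) (\<lambda>y. avg (Suc n) (\<lambda>k.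
       measure_pmf.expectation (Y_law p k) (\<lambda>y'. h (y + y'))))"
proof -
  have p01: "0 \<le> p" "p \<le> 1"
    using p_pos p_less_1 by auto
  have inner: "measure_pmf.expectation (bind_pmf (binomial_pmf (Suc n) p) (\<lambda>b.
       bind_pmf (Y_law p (Suc n - b)) (\<lambda>y'. return_pmf (y + y')))) h =
     avg (Suc n) (\<lambda>k. measure_pmf.expectation (Y_law p k) (\<lambda>y'. h (y + y')))" for y
  proof -
    let ?F = "\<lambda>k. measure_pmf.expectation (Y_law p k) (\<lambda>y'. h (y + y'))"
    have F: "measure_pmf.expectation (bind_pmf (Y_law p k) (\<lambda>y'. return_pmf (y + y'))) h = ?F k" for k
      by (simp flip: map_pmf_def)
    have "measure_pmf.expectation (bind_pmf (binomial_pmf (Suc n) p) (\<lambda>b.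
       bind_pmf (Y_law p (Suc n - b)) (\<lambda>y'. return_pmf (y + y')))) h
       = (\<Sum>b\<le>Suc n. pmf (binomial_pmf (Suc n) p) b * ?F (Suc n - b))"
      by (subst pmf_expectation_bind[of "{..Suc n}"])
        (auto simp: p_pos p_less_1 finite_Y_law F)
    also have "\<dots> = avg (Suc n) ?F"
      unfolding avg_def
    proof (rule sum.reindex_bij_witness[of _ "\<lambda>k. Suc n - k" "\<lambda>k. Suc n - k"])
      fix b assume b: "b \<in> {..Suc n}"
      then show "weight (Suc n) (Suc n - b) * ?F (Suc n - b)
          = pmf (binomial_pmf (Suc n) p) b * ?F (Suc n - b)"
        using p01 binomial_symmetric[of b "Suc n"]
        by (simp add: weight_def flip: q_eq del: binomial_Suc_Suc)
    qed auto
    finally show ?thesis .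
  qed
  have "measure_pmf.expectation (Y_law p (Suc (Suc n))) h =
     (\<Sum>y\<in>set_pmf (Y_law p (Suc n)). pmf (Y_law p (Suc n)) y *
        avg (Suc n) (\<lambda>k. measure_pmf.expectation (Y_law p k) (\<lambda>y'. h (y + y'))))"
    unfolding Y_law.simps
    by (subst pmf_expectation_bind[OF finite_Y_law])
      (auto simp: finite_Y_law p_pos p_less_1 inner)
  also have "\<dots> = measure_pmf.expectation (Y_law p (Suc n)) (\<lambda>y. avg (Suc n) (\<lambda>k.
       measure_pmf.expectation (Y_law p k) (\<lambda>y'. h (y + y'))))"
    by (subst integral_measure_pmf[OF finite_Y_law]) auto
  finally show ?thesis .
qed

lemma m_0: "m 0 = 0" and m_1: "m (Suc 0) = 1"
  by (simp_all add: m_def mean_Y_def)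

lemma m_rec: "m (Suc (Suc n)) = m (Suc n) + avg (Suc n) m"
proof -
  have "m (Suc (Suc n)) = measure_pmf.expectation (Y_law p (Suc n)) (\<lambda>y. avg (Suc n) (\<lambda>k.
       measure_pmf.expectation (Y_law p k) (\<lambda>y'. real y + real y')))"
    unfolding m_def mean_Y_def by (subst expectation_Y_law) simp
  also have "\<dots> = measure_pmf.expectation (Y_law p (Suc n)) (\<lambda>y. real y + avg (Suc n) m)"
    by (simp add: integrable_Y_law avg_add avg_const m_def mean_Y_def[abs_def])
  also have "\<dots> = m (Suc n) + avg (Suc n) m"
    by (simp add: integrable_Y_law m_def mean_Y_def)
  finally show ?thesis .
qed

text \<open>
  The second moment satisfies a linear recursion; the variance recursion is derived from it.
\<close>

definition square_mean :: "nat \<Rightarrow> real" where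
  "square_mean n = measure_pmf.expectation (Y_law p n) (\<lambda>y. (real y)\<^sup>2)"

lemma square_mean_rec:
  "square_mean (Suc (Suc n)) =
     square_mean (Suc n) + 2 * m (Suc n) * avg (Suc n) m + avg (Suc n) square_mean"
proof -
  have "square_mean (Suc (Suc n)) = measure_pmf.expectation (Y_law p (Suc n)) (\<lambda>y. avg (Suc n) (\<lambda>k.
       measure_pmf.expectation (Y_law p k) (\<lambda>y'. (real y)\<^sup>2 + (2 * real y) * real y' + (real y')\<^sup>2)))"
    unfolding square_mean_def by (subst expectation_Y_law) (simp add: power2_sum algebra_simps)
  also have "\<dots> = measure_pmf.expectation (Y_law p (Suc n))
      (\<lambda>y. (real y)\<^sup>2 + (2 * avg (Suc n) m) * real y + avg (Suc n) square_mean)"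
  proof -
    have "measure_pmf.expectation (Y_law p k) (\<lambda>y'. (real y)\<^sup>2 + (2 * real y) * real y' + (real y')\<^sup>2)
       = (real y)\<^sup>2 + (2 * real y) * m k + square_mean k" for y k
      by (simp add: integrable_Y_law m_def mean_Y_def square_mean_def)
    then show ?thesis
      by (simp add: avg_add avg_const avg_cmult mult.assoc) (simp add: mult_ac)
  qed
  also have "\<dots> = square_mean (Suc n) + 2 * m (Suc n) * avg (Suc n) m + avg (Suc n) square_mean"
    by (simp add: integrable_Y_law m_def mean_Y_def square_mean_def)
  finally show ?thesis .
qed

lemma V_eq: "V n = square_mean n - (m n)\<^sup>2"
  unfolding V_def variance_Y_def square_mean_def m_def mean_Y_def
  by (subst measure_pmf.variance_eq) (simp_all add: integrable_Y_law)

lemma V_0: "V 0 = 0" and V_1: "V (Suc 0) = 0"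
  by (simp_all add: V_def variance_Y_def)

lemma V_nonneg: "0 \<le> V n"
  by (simp add: V_def variance_Y_def)

text \<open>
  The law of total variance: the cross term of the second moment recursion cancels against
  \<open>(m + avg m)\<^sup>2\<close>, and what is left over is the variance of the conditional mean.
\<close>

lemma V_rec: "V (Suc (Suc n)) = V (Suc n) + avg (Suc n) V + T (Suc n)"
proof -
  have "avg (Suc n) V = avg (Suc n) square_mean - avg (Suc n) (\<lambda>k. (m k)\<^sup>2)"
    using avg_diff[of "Suc n" square_mean "\<lambda>k. (m k)\<^sup>2"] V_eq by presburger
  then show ?thesis
    by (simp add: V_eq[of "Suc _"] m_rec square_mean_rec T_def power2_sum)
qed

end

section \<open>Upper bound for the growth rate of the mean\<close>

context thinning
begin

definition d :: "nat \<Rightarrow> real" where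
  "d n = m (Suc n) - m n"

lemma d_0: "d 0 = 1"
  by (simp add: d_def m_0 m_1)

text \<open>
  At \<open>n = 0\<close> the identity fails, since \<open>d 0 = 1\<close> while \<open>avg 0 m = 0\<close>; this exception is responsible
  for the exponentially small terms \<open>p ^ n\<close> further down.
\<close>

lemma d_eq_avg: "1 \<le> n \<Longrightarrow> d n = avg n m"
  by (cases n) (simp_all add: d_def m_rec)

lemma m_nonneg: "0 \<le> m n"
  by (simp add: m_def mean_Y_def)

lemma d_nonneg: "0 \<le> d n"
  by (cases "n = 0") (simp_all add: d_0 d_eq_avg avg_nonneg m_nonneg)

lemma mono_m: "i \<le> j \<Longrightarrow> m i \<le> m j"
  by (rule lift_Suc_mono_le[of m]) (use d_nonneg in \<open>auto simp: d_def\<close>)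

lemma m_ge_1: "1 \<le> n \<Longrightarrow> 1 \<le> m n"
  using mono_m[of 1 n] m_1 by simp

lemma m_pos: "1 \<le> n \<Longrightarrow> 0 < m n"
  using m_ge_1[of n] by linarith

lemma avg_m_Suc: "avg (Suc n) m = avg n m + q * avg n d"
  using avg_increment[of n m] by (simp add: d_def[abs_def])

lemma d_Suc: "1 \<le> n \<Longrightarrow> d (Suc n) = d n + q * avg n d"
  by (simp add: d_eq_avg avg_m_Suc)

lemma mono_d:
  assumes "1 \<le> i" "i \<le> j"
  shows "d i \<le> d j"
  using assms(2)
proof (induction j rule: dec_induct)
  case (step n)
  have "0 \<le> q * avg n d"
    using q_pos by (intro mult_nonneg_nonneg avg_nonneg d_nonneg) auto
  then show ?case
    using step d_Suc[of n] assms(1) by linarith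
qed simp

lemma d_ge_q: "q \<le> d n"
proof (cases "n = 0")
  case True
  then show ?thesis using q_less_1 by (simp add: d_0)
next
  case False
  have "d 1 = q"
    by (simp add: d_eq_avg avg_def weight_def m_0 m_1)
  then show ?thesis
    using mono_d[of 1 n] False by simp
qed

lemma d_pos: "0 < d n"
  using d_ge_q[of n] q_pos by linarith

lemma d_le_m: "1 \<le> n \<Longrightarrow> d n \<le> m n"
  using avg_mono[of n m "\<lambda>_. m n"] mono_m by (simp add: d_eq_avg avg_const)

text \<open>
  Symmetrisation over two independent copies. With monotone functions it yields a correlation
  inequality, and with \<open>f = g\<close> it expresses a variance through squared differences, with no
  centring required.
\<close>

lemma avg_covariance:
  "(\<Sum>j\<le>n. \<Sum>k\<le>n. weight n j * weight n k * ((f j - f k) * (g j - g k)))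
    = 2 * (avg n (\<lambda>k. f k * g k) - avg n f * avg n g)"
proof -
  let ?w = "weight n"
  have "(\<Sum>j\<le>n. \<Sum>k\<le>n. ?w j * ?w k * ((f j - f k) * (g j - g k)))
    = (\<Sum>j\<le>n. \<Sum>k\<le>n. (?w j * (f j * g j)) * ?w k) - (\<Sum>j\<le>n. \<Sum>k\<le>n. (?w j * f j) * (?w k * g k))
     - (\<Sum>j\<le>n. \<Sum>k\<le>n. (?w j * g j) * (?w k * f k)) + (\<Sum>j\<le>n. \<Sum>k\<le>n. ?w j * (?w k * (f k * g k)))"
    unfolding sum_subtractf[symmetric] sum.distrib[symmetric]
    by (intro sum.cong refl) (simp add: algebra_simps)
  then show ?thesis
    by (simp only: sum_product[symmetric] sum_weight avg_def[symmetric]) (simp add: mult.commute)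
qed

text \<open>
  Chebyshev's correlation inequality: every term of the symmetrised sum is nonpositive.
\<close>

lemma avg_antimono_mono:
  assumes "\<And>j k. j \<le> k \<Longrightarrow> f k \<le> f j" and "\<And>j k. j \<le> k \<Longrightarrow> g j \<le> g k"
  shows "avg n (\<lambda>k. f k * g k) \<le> avg n f * avg n g"
proof -
  have "(f j - f k) * (g j - g k) \<le> 0" for j k
    using assms[of j k] assms[of k j] by (cases "j \<le> k") (auto simp: mult_le_0_iff)
  then have "(\<Sum>j\<le>n. \<Sum>k\<le>n. weight n j * weight n k * ((f j - f k) * (g j - g k))) \<le> 0"
    by (intro sum_nonpos mult_nonneg_nonpos[of "weight n _ * weight n _"]) (simp_all add: weight_nonneg)
  then show ?thesis
    by (simp add: avg_covariance)
qed

text \<open>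
  Size biasing: \<open>E 1 / (B\<^sub>n + 1)\<close> is \<open>1 / ((n + 1) q)\<close> times the probability that \<open>B\<^bsub>n+1\<^esub>\<close> is
  positive.
\<close>

lemma avg_inverse_Suc: "avg n (\<lambda>k. 1 / (real k + 1)) \<le> 1 / ((real n + 1) * q)"
proof -
  have "real (Suc n) * q * avg n (\<lambda>k. 1 / real (Suc k)) = avg (Suc n) (\<lambda>k. real k * (1 / real k))"
    using avg_absorb[of "Suc n" "\<lambda>k. 1 / real k"] by simp
  also have "\<dots> \<le> avg (Suc n) (\<lambda>_. 1)"
    by (rule avg_mono) auto
  finally have "avg n (\<lambda>k. 1 / (real k + 1)) * ((real n + 1) * q) \<le> 1"
    by (simp add: avg_const algebra_simps)
  then show ?thesis
    using q_pos by (subst le_divide_eq) simp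
qed

text \<open>
  This is \<open>ln \<kappa>\<close>.
\<close>

definition lam :: real where "lam = - ln q"

lemma lam_pos: "0 < lam"
  using q_pos q_less_1 by (simp add: lam_def)

text \<open>
  The upper barrier for \<open>d n / m n\<close>. The expected growth rate corresponds to \<open>c = 1 / lam\<close>; any
  larger \<open>c\<close> will be reached.
\<close>

definition H :: "real \<Rightarrow> real \<Rightarrow> nat \<Rightarrow> real" where
  "H A c n = (A + c * ln (real n + 1)) / (real n + 1)"

lemma H_antimono:
  assumes "0 \<le> c" "c \<le> A" "j \<le> k"
  shows "H A c k \<le> H A c j"
proof -
  let ?y = "real j + 1" and ?z = "real k + 1"
  have y: "1 \<le> ?y" "?y \<le> ?z"
    using assms by auto
  have "c * ln (?z / ?y) \<le> c * (?z / ?y - 1)"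
    using assms y by (intro mult_left_mono ln_le_minus_one) auto
  also have "\<dots> \<le> (A + c * ln ?y) * (?z / ?y - 1)"
    using assms y by (intro mult_right_mono) (auto simp: field_simps intro: add_increasing2)
  finally have "A + c * ln ?z \<le> (A + c * ln ?y) * (?z / ?y)"
    using y by (simp add: ln_div algebra_simps)
  then show ?thesis
    using y by (simp add: H_def divide_simps)
qed

text \<open>
  Jensen's inequality for the concave function \<open>x \<mapsto> x (A + c ln (1 / x))\<close> at \<open>x = 1 / (B\<^sub>n + 1)\<close>,
  whose mean is at most \<open>1 / ((n + 1) q)\<close>. The tangent line is produced by \<open>ln t \<le> t - 1\<close>, and the
  second hypothesis says that its slope is nonnegative.
\<close>

lemma avg_H_le:
  assumes "0 \<le> c" and "c \<le> A + c * ln ((real n + 1) * q)"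
  shows "avg n (H A c) \<le> (A + c * ln ((real n + 1) * q)) / ((real n + 1) * q)"
proof -
  let ?N = "(real n + 1) * q"
  have N: "0 < ?N"
    using q_pos by simp
  let ?a = "A + c * ln ?N - c"
  have "H A c k \<le> ?a * (1 / (real k + 1)) + c / ?N" for k
  proof -
    let ?z = "real k + 1"
    have "c / ?z * ln (?z / ?N) \<le> c / ?z * (?z / ?N - 1)"
      using assms N by (intro mult_left_mono ln_le_minus_one) auto
    also have "\<dots> = c / ?N - c / ?z"
      using N by (simp add: field_simps)
    also have "ln (?z / ?N) = ln ?z - ln ?N"
      using N q_pos by (subst ln_div) auto
    finally have "c / ?z * (ln ?z - ln ?N) \<le> c / ?N - c / ?z" .
    then show ?thesis
      by (simp add: H_def add_divide_distrib diff_divide_distrib algebra_simps)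
  qed
  then have "avg n (H A c) \<le> avg n (\<lambda>k. ?a * (1 / (real k + 1)) + c / ?N)"
    by (intro avg_mono) auto
  also have "\<dots> = ?a * avg n (\<lambda>k. 1 / (real k + 1)) + c / ?N"
    by (simp only: avg_add avg_cmult avg_const)
  also have "\<dots> \<le> ?a * (1 / ?N) + c / ?N"
    using assms avg_inverse_Suc by (intro add_right_mono mult_left_mono) auto
  also have "\<dots> = (A + c * ln ?N) / ?N"
    by (simp add: diff_divide_distrib add_divide_distrib)
  finally show ?thesis .
qed

text \<open>
  The increment of \<open>d\<close> is \<open>q E d(B\<^sub>n) \<le> q E (H m)(B\<^sub>n) \<le> q (E H(B\<^sub>n)) d n\<close> by negative correlation, up to
  the exceptional value \<open>d 0\<close>. Evaluating \<open>H\<close> near \<open>q n\<close> instead of \<open>n\<close> lowers the logarithm by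
  \<open>lam\<close>, and this is the gain \<open>c * lam / (n + 1)\<close> that makes the barrier work.
\<close>

lemma d_Suc_le:
  assumes "0 \<le> c" "c \<le> A" "c \<le> A + c * ln ((real n + 1) * q)" "1 \<le> n"
    and bound: "\<And>j. 1 \<le> j \<Longrightarrow> j \<le> n \<Longrightarrow> d j \<le> H A c j * m j"
  shows "d (Suc n) \<le> d n * (1 + H A c n - c * lam / (real n + 1) + p ^ n)"
proof -
  have "d k \<le> (if k = 0 then 1 else 0) + H A c k * m k" if "k \<le> n" for k
    using bound[of k] that by (cases "k = 0") (auto simp: d_0 m_0)
  then have "avg n d \<le> avg n (\<lambda>k. (if k = 0 then 1 else 0) + H A c k * m k)"
    by (rule avg_mono)
  also have "\<dots> = avg n (\<lambda>k. if k = 0 then 1 else 0) + avg n (\<lambda>k. H A c k * m k)"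
    by (simp add: avg_add)
  also have "avg n (\<lambda>k. if k = 0 then 1 else 0) = p ^ n"
    by (simp add: avg_def weight_def if_distrib[of "\<lambda>x. _ * x"] sum.delta cong: if_cong)
  also have "avg n (\<lambda>k. H A c k * m k) \<le> avg n (H A c) * avg n m"
    using assms by (intro avg_antimono_mono H_antimono mono_m) auto
  also have "\<dots> \<le> (A + c * ln ((real n + 1) * q)) / ((real n + 1) * q) * d n"
    using assms by (simp only: d_eq_avg[symmetric]) (intro mult_right_mono avg_H_le d_nonneg)
  finally have "q * avg n d \<le> q * (p ^ n + (A + c * ln ((real n + 1) * q)) / ((real n + 1) * q) * d n)"
    using q_pos by (intro mult_left_mono) auto
  also have "\<dots> = q * p ^ n + (H A c n - c * lam / (real n + 1)) * d n"
  proof -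
    have "ln ((real n + 1) * q) = ln (real n + 1) - lam"
      using q_pos by (subst ln_mult) (auto simp: lam_def)
    then have "(A + c * ln ((real n + 1) * q)) / ((real n + 1) * q) = (H A c n - c * lam / (real n + 1)) / q"
      using q_pos by (simp add: H_def divide_simps) (simp add: algebra_simps)
    moreover have "q * (x + y / q * z) = q * x + y * z" for x y z
      using q_pos by (simp add: distrib_left)
    ultimately show ?thesis
      by (simp only:)
  qed
  also have "q * p ^ n \<le> d n * p ^ n"
    using d_ge_q[of n] p_pos by (intro mult_right_mono) auto
  finally show ?thesis
    using d_Suc[OF \<open>1 \<le> n\<close>] by (simp add: algebra_simps)
qed

text \<open>
  Put \<open>u = H A c k\<close> and \<open>r = k + 1\<close>. Passing from \<open>k\<close> to \<open>k + 1\<close> multiplies \<open>d\<close> by at most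
  \<open>1 + u - c lam / r + p ^ k\<close>, and \<open>m\<close> by \<open>1 + d k / m k\<close>; since \<open>x \<mapsto> x / (1 + x)\<close> increases, the
  quotient \<open>d / m\<close> stays below \<open>u (1 + u - c lam / r + p ^ k) / (1 + u)\<close>. The condition \<open>step2\<close> makes
  this at most \<open>u r / (r + 1)\<close>, which lies below the next value of the barrier.
\<close>

lemma d_le_H_induct:
  assumes "0 \<le> c" "c \<le> A" "1 \<le> N"
    and base: "\<And>n. 1 \<le> n \<Longrightarrow> n \<le> N \<Longrightarrow> d n \<le> H A c n * m n"
    and step1: "\<And>n. N \<le> n \<Longrightarrow> c \<le> A + c * ln ((real n + 1) * q)"
    and step2: "\<And>n. N \<le> n \<Longrightarrow> H A c n + (real n + 2) * p ^ n \<le> c * lam - 1"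
  shows "1 \<le> n \<Longrightarrow> d n \<le> H A c n * m n"
proof (induction n rule: less_induct)
  case (less n)
  show ?case
  proof (cases "n \<le> N")
    case True
    then show ?thesis using less base by simp
  next
    case False
    then obtain k where k: "n = Suc k" "N \<le> k" "1 \<le> k"
      using assms by (cases n) auto
    define u where "u = H A c k"
    define r where "r = real k + 1"
    have u: "0 \<le> u"
      using assms by (auto simp: u_def H_def)
    have r: "0 < r"
      by (simp add: r_def)
    have hyp: "d k \<le> u * m k"
      unfolding u_def using less k by simp
    have m: "m n = m k + d k"
      by (simp add: k d_def)
    have "d n \<le> d k * (1 + u - c * lam / r + p ^ k)"
      unfolding k u_def r_def using assms less k by (intro d_Suc_le) auto
    also have "1 + u - c * lam / r + p ^ k \<le> (1 + u) * (r / (r + 1))"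
    proof -
      have r2: "r + 1 = real k + 2"
        by (simp add: r_def)
      have "(1 + u) + (r + 1) * p ^ k \<le> c * lam"
        unfolding r2 u_def using step2[OF k(2)] by linarith
      then have "((1 + u) + (r + 1) * p ^ k) / (r + 1) \<le> c * lam / (r + 1)"
        using r by (intro divide_right_mono) auto
      also have "\<dots> \<le> c * lam / r"
        using r assms(1) lam_pos by (intro divide_left_mono) auto
      finally have "(1 + u) / (r + 1) + p ^ k \<le> c * lam / r"
        using r by (simp add: add_divide_distrib)
      moreover have "(1 + u) * (r / (r + 1)) = (1 + u) - (1 + u) / (r + 1)"
        using r by (simp add: field_simps)
      ultimately show ?thesis
        by linarith
    qed
    finally have "d n \<le> d k * ((1 + u) * (r / (r + 1)))"
      using d_nonneg[of k] by (simp add: mult_left_mono)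
    also have "\<dots> = d k * (1 + u) * (r / (r + 1))"
      by (simp only: mult.assoc)
    also have "\<dots> \<le> u * m n * (r / (r + 1))"
      using hyp r by (intro mult_right_mono) (simp_all add: m algebra_simps)
    also have "u * m n * (r / (r + 1)) = (A + c * ln r) / (r + 1) * m n"
      using r by (simp add: u_def H_def r_def)
    also have "\<dots> \<le> H A c n * m n"
      using assms(1) m_nonneg r by (simp add: H_def k r_def divide_right_mono mult_left_mono mult_right_mono)
    finally show ?thesis .
  qed
qed

text \<open>
  The trivial bound \<open>d \<le> m\<close> starts the induction if \<open>A\<close> is as large as the starting index \<open>N\<close>. Then
  \<open>H A c n\<close> is of order one at \<open>n = N\<close>, and \<open>c = 4 / lam\<close> is large enough to tolerate that.
\<close>

lemma d_le_H_crude: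
  obtains A where "4 / lam \<le> A" "\<And>n. 1 \<le> n \<Longrightarrow> d n \<le> H A (4 / lam) n * m n"
proof -
  define c where "c = 4 / lam"
  have c: "0 < c"
    using lam_pos by (simp add: c_def)
  have "eventually (\<lambda>n::nat. (c + 3 + c * ln (real n + 1)) / (real n + 1) \<le> 1) sequentially"
    using c by real_asymp
  moreover have "eventually (\<lambda>n::nat. (real n + 2) * p ^ n \<le> 1) sequentially"
    using p_pos p_less_1 by real_asymp
  moreover have "eventually (\<lambda>n::nat. 1 \<le> (real n + 1) * q) sequentially"
    using q_pos by real_asymp
  moreover have "eventually (\<lambda>n::nat. 1 \<le> n) sequentially"
    by (rule eventually_ge_at_top)
  ultimately have "eventually (\<lambda>n::nat. (c + 3 + c * ln (real n + 1)) / (real n + 1) \<le> 1 \<and>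
      (real n + 2) * p ^ n \<le> 1 \<and> 1 \<le> (real n + 1) * q \<and> 1 \<le> n) sequentially"
    by eventually_elim auto
  then obtain N where N: "\<And>n. N \<le> n \<Longrightarrow> (c + 3 + c * ln (real n + 1)) / (real n + 1) \<le> 1 \<and>
      (real n + 2) * p ^ n \<le> 1 \<and> 1 \<le> (real n + 1) * q \<and> 1 \<le> n"
    unfolding eventually_sequentially by auto
  define A where "A = c + real N + 1"
  have "d n \<le> H A c n * m n" if "1 \<le> n" for n
  proof (rule d_le_H_induct[where N = N, OF _ _ _ _ _ _ that])
    fix k assume k: "1 \<le> k" "k \<le> N"
    have "1 \<le> H A c k"
      using k c mult_nonneg_nonneg[of c "ln (real k + 1)"]
      by (simp add: H_def A_def del: mult_nonneg_nonneg)
    then show "d k \<le> H A c k * m k"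
      using d_le_m[OF k(1)] m_nonneg[of k] mult_right_mono[of 1 "H A c k" "m k"] by linarith
  next
    fix k assume k: "N \<le> k"
    show "c \<le> A + c * ln ((real k + 1) * q)"
      using N[OF k] c by (simp add: A_def add_increasing2)
    have "H A c k \<le> 2"
      using N[OF k] k c by (simp add: H_def A_def field_simps)
    then show "H A c k + (real k + 2) * p ^ k \<le> c * lam - 1"
      using N[OF k] lam_pos by (simp add: c_def)
  qed (use N[of N] c in \<open>auto simp: A_def\<close>)
  then show ?thesis
    using that[of A] by (simp add: A_def c_def)
qed

text \<open>
  The crude bound lets the induction start at \<open>N\<close> with \<open>A\<close> only logarithmic in \<open>N\<close>. Then \<open>H A c n\<close>
  is small for all \<open>n \<ge> N\<close>, so that every \<open>c\<close> above \<open>1 / lam\<close> is admissible.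
\<close>

lemma d_le_H_sharp:
  assumes "0 < \<epsilon>"
  obtains A where "(1 + \<epsilon>) / lam \<le> A" "\<And>n. 1 \<le> n \<Longrightarrow> d n \<le> H A ((1 + \<epsilon>) / lam) n * m n"
proof -
  define c0 where "c0 = 4 / lam"
  obtain A0 where A0: "c0 \<le> A0" "\<And>n. 1 \<le> n \<Longrightarrow> d n \<le> H A0 c0 n * m n"
    using d_le_H_crude unfolding c0_def by blast
  define c where "c = (1 + \<epsilon>) / lam"
  have c: "0 < c" "0 < c0"
    using lam_pos assms by (auto simp: c_def c0_def)
  have "eventually (\<lambda>n::nat. (A0 + c + c0 * ln (real n + 1) + c * ln (real n + 1)) / (real n + 1) \<le> \<epsilon> / 2) sequentially"
    using assms by real_asymp
  moreover have "eventually (\<lambda>n::nat. (real n + 2) * p ^ n \<le> \<epsilon> / 2) sequentially"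
    using p_pos p_less_1 assms by real_asymp
  moreover have "eventually (\<lambda>n::nat. 1 \<le> (real n + 1) * q) sequentially"
    using q_pos by real_asymp
  moreover have "eventually (\<lambda>n::nat. 1 \<le> n) sequentially"
    by (rule eventually_ge_at_top)
  ultimately have "eventually (\<lambda>n::nat. (A0 + c + c0 * ln (real n + 1) + c * ln (real n + 1)) / (real n + 1) \<le> \<epsilon> / 2 \<and>
      (real n + 2) * p ^ n \<le> \<epsilon> / 2 \<and> 1 \<le> (real n + 1) * q \<and> 1 \<le> n) sequentially"
    by eventually_elim auto
  then obtain N where N: "\<And>n. N \<le> n \<Longrightarrow>
      (A0 + c + c0 * ln (real n + 1) + c * ln (real n + 1)) / (real n + 1) \<le> \<epsilon> / 2 \<and>
      (real n + 2) * p ^ n \<le> \<epsilon> / 2 \<and> 1 \<le> (real n + 1) * q \<and> 1 \<le> n"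
    unfolding eventually_sequentially by auto
  \<comment> \<open>This \<open>A\<close> makes \<open>H A c\<close> dominate the crude barrier \<open>H A0 c0\<close> on \<open>{1..N}\<close>.\<close>
  define A where "A = A0 + c + c0 * ln (real N + 1)"
  have A: "c \<le> A"
    using A0 c by (simp add: A_def)
  have "d n \<le> H A c n * m n" if "1 \<le> n" for n
  proof (rule d_le_H_induct[where N = N, OF _ _ _ _ _ _ that])
    fix k assume k: "1 \<le> k" "k \<le> N"
    have "c0 * ln (real k + 1) \<le> c0 * ln (real N + 1)"
      using c k by simp
    moreover have "0 \<le> c * ln (real k + 1)"
      using c by simp
    ultimately have "H A0 c0 k \<le> H A c k"
      unfolding H_def A_def using c by (intro divide_right_mono) linarith+
    then show "d k \<le> H A c k * m k"
      using A0(2)[OF k(1)] m_nonneg[of k] mult_right_mono[of "H A0 c0 k" "H A c k" "m k"] by linarith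
  next
    fix k assume k: "N \<le> k"
    show "c \<le> A + c * ln ((real k + 1) * q)"
      using N[OF k] c A by (simp add: add_increasing2)
    have "A \<le> A0 + c + c0 * ln (real k + 1)"
      using k c by (simp add: A_def)
    then have "H A c k \<le> (A0 + c + c0 * ln (real k + 1) + c * ln (real k + 1)) / (real k + 1)"
      unfolding H_def by (intro divide_right_mono) auto
    then have "H A c k \<le> \<epsilon> / 2"
      using N[OF k] by linarith
    then show "H A c k + (real k + 2) * p ^ k \<le> c * lam - 1"
      using N[OF k] lam_pos by (simp add: c_def)
  qed (use N[of N] c A in auto)
  then show ?thesis
    using that[of A] A by (simp add: c_def)
qed

end

section \<open>Binomial concentration and slowly varying sequences\<close>

context thinning
begin

lemma one_minus_q: "1 - q = p"
  by (simp add: q_eq)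

text \<open>
  The exponent lies strictly between \<open>1/2\<close>, so that large deviations leave the window with
  probability only \<open>exp (- 2 n\<^bsup>1/3\<^esup>)\<close>, and \<open>4/5\<close>, so that slow sequences in the sense below are nearly constant
  on a window.
\<close>

definition window :: "nat \<Rightarrow> nat set" where
  "window n = {k. k \<le> n \<and> \<bar>real k - real n * q\<bar> \<le> real n powr (2/3)}"

definition tail :: "nat \<Rightarrow> real" where
  "tail n = (\<Sum>k\<in>{..n} - window n. weight n k)"

definition centre :: "nat \<Rightarrow> nat" where
  "centre n = nat \<lfloor>real n * q\<rfloor>"

lemma tail_nonneg: "0 \<le> tail n"
  by (simp add: tail_def sum_nonneg weight_nonneg)

lemma tail_le:
  assumes "0 < n"
  shows "tail n \<le> 2 * exp (- 2 * real n powr (1/3))"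
proof -
  interpret binomial_distribution n q
    using q_pos q_less_1 by unfold_locales auto
  let ?B = "binomial_pmf n q" and ?\<epsilon> = "real n powr (2/3)"
  have "tail n = measure_pmf.prob ?B ({..n} - window n)"
    unfolding tail_def using q_pos q_less_1
    by (subst measure_measure_pmf_finite) (auto simp: weight_def one_minus_q intro!: sum.cong)
  also have "\<dots> \<le> measure_pmf.prob ?B {x. ?\<epsilon> \<le> \<bar>real x - real n * q\<bar>}"
    by (intro measure_pmf.finite_measure_mono) (auto simp: window_def)
  also have "\<dots> \<le> 2 * exp (- 2 * ?\<epsilon>\<^sup>2 / n)"
    using assms by (intro prob_abs_ge) auto
  also have "- 2 * ?\<epsilon>\<^sup>2 / n = - 2 * real n powr (1/3)"
  proof -
    have "?\<epsilon>\<^sup>2 / real n = real n powr (4/3) / real n powr 1"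
      using assms by (simp add: power2_eq_square flip: powr_add)
    also have "\<dots> = real n powr (1/3)"
      by (simp only: powr_diff[symmetric]) simp
    finally show ?thesis by simp
  qed
  finally show ?thesis .
qed

lemma ln_m_Suc_le:
  assumes "1 \<le> n" "d n \<le> H A c n * m n"
  shows "ln (m (Suc n)) - ln (m n) \<le> H A c n"
proof -
  have m: "0 < m n"
    using m_pos assms by blast
  have r: "m (Suc n) / m n = 1 + d n / m n"
    using m by (simp add: d_def field_simps)
  have "ln (m (Suc n)) - ln (m n) = ln (m (Suc n) / m n)"
    using m m_pos[of "Suc n"] by (simp add: ln_div)
  also have "\<dots> \<le> d n / m n"
    unfolding r using m d_nonneg[of n] by (intro ln_add_one_self_le_self) auto
  also have "\<dots> \<le> H A c n"
    using assms m by (simp add: divide_le_eq)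
  finally show ?thesis .
qed

text \<open>
  By the crude bound \<open>ln (m n)\<close> exceeds \<open>n\<^bsup>1/4\<^esup>\<close> by at most a constant, hence Hoeffding's bound
  \<open>exp (- 2 n\<^bsup>1/3\<^esup>)\<close> beats every fixed power of \<open>m\<close> and of \<open>n\<close>.
\<close>

lemma tail_negligible: "eventually (\<lambda>n. tail n * ((real n)\<^sup>2 * (m n)\<^sup>2) \<le> 1 / (real n)\<^sup>2) sequentially"
proof -
  obtain A where A: "4 / lam \<le> A" "\<And>n. 1 \<le> n \<Longrightarrow> d n \<le> H A (4 / lam) n * m n"
    using d_le_H_crude by blast
  define c where "c = 4 / lam"
  have c: "0 < c" "0 < A"
    using lam_pos A(1) by (auto simp: c_def intro: less_le_trans[of 0 "4 / lam"])
  have "eventually (\<lambda>n::nat. (A + c * ln (real n + 1)) / (real n + 1) \<le>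
      (real n + 1) powr (1/4) - real n powr (1/4)) sequentially"
    using c by real_asymp
  then obtain N where N: "\<And>n. N \<le> n \<Longrightarrow> H A c n \<le> real (Suc n) powr (1/4) - real n powr (1/4)"
    unfolding eventually_sequentially H_def by (auto simp: add_ac)
  define M where "M = max 1 N"
  define K where "K = ln (m M)"
  have ln_m: "ln (m n) \<le> K + real n powr (1/4)" if "M \<le> n" for n
  proof -
    have "ln (m n) - ln (m M) \<le> real n powr (1/4) - real M powr (1/4)"
      using that
    proof (induction n rule: dec_induct)
      case (step n)
      then have "ln (m (Suc n)) - ln (m n) \<le> H A c n"
        using A(2)[of n] by (intro ln_m_Suc_le) (auto simp: c_def M_def)
      also have "\<dots> \<le> real (Suc n) powr (1/4) - real n powr (1/4)"
        using step N[of n] by (auto simp: M_def)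
      finally show ?case
        using step by linarith
    qed simp
    then show ?thesis
      unfolding K_def using powr_ge_zero[of "real M" "1/4"] by linarith
  qed
  have "eventually (\<lambda>n::nat. 2 * exp (- 2 * real n powr (1/3)) * ((exp (K + real n powr (1/4)))\<^sup>2 * real n ^ 4) \<le> 1) sequentially"
    by real_asymp
  then show ?thesis
    using eventually_ge_at_top[of M]
  proof eventually_elim
    case (elim n)
    have n: "1 \<le> n"
      using elim(2) by (simp add: M_def)
    have "m n \<le> exp (K + real n powr (1/4))"
      using ln_m[OF elim(2)] m_pos[OF n] by (metis exp_le_cancel_iff exp_ln)
    then have "tail n * ((m n)\<^sup>2 * real n ^ 4) \<le>
        2 * exp (- 2 * real n powr (1/3)) * ((exp (K + real n powr (1/4)))\<^sup>2 * real n ^ 4)"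
      using n m_nonneg tail_nonneg by (intro mult_mono tail_le power_mono) auto
    then have "tail n * ((m n)\<^sup>2 * real n ^ 4) \<le> 1"
      using elim(1) by linarith
    moreover have "real n ^ 4 = (real n)\<^sup>2 * (real n)\<^sup>2"
      by (simp flip: power_add)
    ultimately have "tail n * ((real n)\<^sup>2 * (m n)\<^sup>2) * (real n)\<^sup>2 \<le> 1"
      by (simp only: mult_ac)
    then show ?case
      using n by (subst le_divide_eq) simp
  qed
qed

text \<open>
  Logarithmic increments of order \<open>(ln n) / n\<close> are typical for the sequences of interest; the
  exponent \<open>-4/5\<close> leaves room for the logarithm. The condition is stable under products.
\<close>

definition slow :: "(nat \<Rightarrow> real) \<Rightarrow> bool" where
  "slow \<phi> \<longleftrightarrow> eventually (\<lambda>n. 0 < \<phi> n) sequentially \<and>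
     (\<lambda>n. ln (\<phi> (Suc n)) - ln (\<phi> n)) \<in> O(\<lambda>n. real n powr (-4/5))"

lemma slow_mult:
  assumes "slow f" "slow g"
  shows "slow (\<lambda>n. f n * g n)"
proof -
  have pos: "eventually (\<lambda>n. 0 < f n) sequentially" "eventually (\<lambda>n. 0 < g n) sequentially"
    using assms by (auto simp: slow_def)
  have "(\<lambda>n. (ln (f (Suc n)) - ln (f n)) + (ln (g (Suc n)) - ln (g n))) \<in> O(\<lambda>n. real n powr (-4/5))"
    by (intro sum_in_bigo(1) assms[unfolded slow_def, THEN conjunct2])
  also have "?this \<longleftrightarrow> (\<lambda>n. ln (f (Suc n) * g (Suc n)) - ln (f n * g n)) \<in> O(\<lambda>n. real n powr (-4/5))"
  proof (rule landau_o.big.in_cong)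
    show "eventually (\<lambda>n. (ln (f (Suc n)) - ln (f n)) + (ln (g (Suc n)) - ln (g n))
        = ln (f (Suc n) * g (Suc n)) - ln (f n * g n)) sequentially"
      using pos[THEN eventually_Suc] pos by eventually_elim (simp add: ln_mult)
  qed
  finally show ?thesis
    using pos unfolding slow_def by (auto elim: eventually_elim2)
qed

lemma eventually_m_pos: "eventually (\<lambda>n. 0 < m n) sequentially"
  using eventually_ge_at_top[of 1] by eventually_elim (rule m_pos)

lemma slow_m: "slow m"
proof -
  obtain A where A: "4 / lam \<le> A" "\<And>n. 1 \<le> n \<Longrightarrow> d n \<le> H A (4 / lam) n * m n"
    using d_le_H_crude by blast
  have "(\<lambda>n. ln (m (Suc n)) - ln (m n)) \<in> O(H A (4 / lam))"
  proof (rule bigoI[where c = 1], use eventually_ge_at_top[of 1] in eventually_elim)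
    case (elim n)
    have "ln (m n) \<le> ln (m (Suc n))"
      using m_pos[OF elim] mono_m[of n "Suc n"] by simp
    then show ?case
      using ln_m_Suc_le[OF elim A(2)[OF elim]] by simp
  qed
  also have "H A (4 / lam) \<in> O(\<lambda>n. real n powr (-4/5))"
    unfolding H_def[abs_def] by real_asymp
  finally show ?thesis
    using eventually_m_pos by (simp add: slow_def)
qed

lemma slow_d: "slow d"
proof -
  obtain A where A: "4 / lam \<le> A" "\<And>n. 1 \<le> n \<Longrightarrow> d n \<le> H A (4 / lam) n * m n"
    using d_le_H_crude by blast
  define c where "c = 4 / lam"
  have c: "0 < c" "0 \<le> A"
    using lam_pos A(1) by (auto simp: c_def intro: order_trans[of 0 "4 / lam"])
  have "eventually (\<lambda>n::nat. 1 \<le> (real n + 1) * q) sequentially"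
    using q_pos by real_asymp
  then have "eventually (\<lambda>n. norm (ln (d (Suc n)) - ln (d n)) \<le> 1 * norm (H A c n + p ^ n)) sequentially"
    using eventually_ge_at_top[of 1]
  proof eventually_elim
    case (elim n)
    have H: "0 \<le> H A c n"
      using c by (auto simp: H_def)
    have "d (Suc n) \<le> d n * (1 + H A c n - c * lam / (real n + 1) + p ^ n)"
      using elim A c by (intro d_Suc_le) (auto simp: c_def intro!: add_increasing2)
    also have "\<dots> \<le> d n * (1 + (H A c n + p ^ n))"
      using c lam_pos d_nonneg by (intro mult_left_mono) auto
    finally have "d (Suc n) / d n \<le> 1 + (H A c n + p ^ n)"
      using d_pos[of n] by (simp add: divide_le_eq mult.commute)
    then have "ln (d (Suc n) / d n) \<le> ln (1 + (H A c n + p ^ n))"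
      using d_pos by (intro ln_mono) auto
    also have "\<dots> \<le> H A c n + p ^ n"
      using H p_pos by (intro ln_add_one_self_le_self) auto
    finally have "ln (d (Suc n)) - ln (d n) \<le> H A c n + p ^ n"
      using d_pos[of n] d_pos[of "Suc n"] by (simp add: ln_div)
    moreover have "ln (d n) \<le> ln (d (Suc n))"
      using mono_d[OF elim(2), of "Suc n"] d_pos[of n] by simp
    ultimately show ?case
      by simp
  qed
  then have "(\<lambda>n. ln (d (Suc n)) - ln (d n)) \<in> O(\<lambda>n. H A c n + p ^ n)"
    by (rule bigoI)
  also have "(\<lambda>n. H A c n + p ^ n) \<in> O(\<lambda>n. real n powr (-4/5))"
    unfolding H_def[abs_def] using p_pos p_less_1 by real_asymp
  finally show ?thesis
    by (simp add: slow_def d_pos)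
qed

lemma centre_in_window: "1 \<le> n \<Longrightarrow> centre n \<in> window n"
proof -
  assume n: "1 \<le> n"
  have nq: "0 \<le> real n * q" "real n * q \<le> real n"
    using q_pos q_less_1 by (auto simp: mult_left_le)
  then have c: "real (centre n) = of_int \<lfloor>real n * q\<rfloor>"
    unfolding centre_def by simp
  have "1 \<le> real n powr (2/3)"
    using n by (simp add: ge_one_powr_ge_zero)
  moreover have "\<bar>real (centre n) - real n * q\<bar> \<le> 1"
    unfolding c by linarith
  moreover have "real (centre n) \<le> real n"
    unfolding c using nq by linarith
  ultimately show ?thesis
    by (simp add: window_def)
qed

lemma window_ge: "eventually (\<lambda>n. \<forall>k\<in>window n. real n * q / 2 \<le> real k) sequentially"
proof -
  have "eventually (\<lambda>n::nat. real n powr (2/3) \<le> real n * q / 2) sequentially"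
    using q_pos by real_asymp
  then show ?thesis
    by eventually_elim (auto simp: window_def)
qed

lemma slow_window:
  assumes "slow \<phi>" "0 < \<epsilon>"
  shows "eventually (\<lambda>n. \<forall>j\<in>window n. \<forall>k\<in>window n. 0 < \<phi> j \<and> \<phi> j \<le> (1 + \<epsilon>) * \<phi> k) sequentially"
proof -
  obtain C where C: "0 < C" "eventually (\<lambda>n. norm (ln (\<phi> (Suc n)) - ln (\<phi> n)) \<le> C * norm (real n powr (-4/5))) sequentially"
    using assms(1) landau_o.bigE unfolding slow_def by blast
  moreover have "eventually (\<lambda>n. 0 < \<phi> n) sequentially"
    using assms(1) by (simp add: slow_def)
  ultimately have "eventually (\<lambda>n. 0 < \<phi> n \<and> \<bar>ln (\<phi> (Suc n)) - ln (\<phi> n)\<bar> \<le> C * real n powr (-4/5)) sequentially"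
    by (auto elim: eventually_elim2)
  then obtain N where N: "\<And>n. N \<le> n \<Longrightarrow> 0 < \<phi> n"
      "\<And>n. N \<le> n \<Longrightarrow> \<bar>ln (\<phi> (Suc n)) - ln (\<phi> n)\<bar> \<le> C * real n powr (-4/5)"
    unfolding eventually_sequentially by blast
  have "eventually (\<lambda>n::nat. 2 * real n powr (2/3) * (C * (real n * q / 2) powr (-4/5)) \<le> ln (1 + \<epsilon>)) sequentially"
    using assms(2) C(1) q_pos by real_asymp
  moreover have "eventually (\<lambda>n::nat. real N + 1 \<le> real n * q / 2) sequentially"
    using q_pos by real_asymp
  ultimately show ?thesis
    using window_ge
  proof eventually_elim
    case (elim n)
    have "\<bar>ln (\<phi> j) - ln (\<phi> i)\<bar> \<le> ln (1 + \<epsilon>)" if "i \<in> window n" "j \<in> window n" "i \<le> j" for i j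
    proof -
      have i: "real n * q / 2 \<le> real i"
        using elim that by blast
      have "\<bar>ln (\<phi> (Suc l)) - ln (\<phi> l)\<bar> \<le> C * (real n * q / 2) powr (-4/5)" if "i \<le> l" for l
      proof -
        have "N \<le> l"
          using i elim(2) that by linarith
        then have "\<bar>ln (\<phi> (Suc l)) - ln (\<phi> l)\<bar> \<le> C * real l powr (-4/5)"
          by (rule N)
        also have "\<dots> \<le> C * (real n * q / 2) powr (-4/5)"
          using i elim(2) that C(1) by (intro mult_left_mono powr_mono2') auto
        finally show ?thesis .
      qed
      then have "\<bar>ln (\<phi> j) - ln (\<phi> i)\<bar> \<le> (real j - real i) * (C * (real n * q / 2) powr (-4/5))"
        using that by (intro ln_difference_le) auto
      also have "\<dots> \<le> 2 * real n powr (2/3) * (C * (real n * q / 2) powr (-4/5))"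
        using that C(1) by (intro mult_right_mono) (auto simp: window_def)
      finally show ?thesis
        using elim(1) by linarith
    qed
    then have *: "\<bar>ln (\<phi> j) - ln (\<phi> k)\<bar> \<le> ln (1 + \<epsilon>)" if "j \<in> window n" "k \<in> window n" for j k
      using that abs_minus_commute[of "ln (\<phi> j)" "ln (\<phi> k)"]
      by (metis nat_le_linear)
    have pos: "0 < \<phi> k" if "k \<in> window n" for k
    proof (rule N)
      have "real n * q / 2 \<le> real k"
        using elim that by blast
      then show "N \<le> k"
        using elim(2) by linarith
    qed
    show ?case
    proof (intro ballI conjI pos)
      fix j k assume jk: "j \<in> window n" "k \<in> window n"
      have "ln (\<phi> j) \<le> ln (1 + \<epsilon>) + ln (\<phi> k)"
        using *[OF jk] by linarith
      also have "\<dots> = ln ((1 + \<epsilon>) * \<phi> k)"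
        using pos[OF jk(2)] assms(2) by (simp add: ln_mult)
      finally show "\<phi> j \<le> (1 + \<epsilon>) * \<phi> k"
        using pos[OF jk(1)] pos[OF jk(2)] assms(2) by (subst (asm) ln_le_cancel_iff) auto
    qed
  qed
qed

lemma centre_at_top: "filterlim centre at_top sequentially"
  unfolding centre_def using q_pos by real_asymp

lemma slow_window_centre:
  assumes "slow \<phi>" "0 < \<epsilon>" "\<epsilon> \<le> 1"
  shows "eventually (\<lambda>n. \<forall>k\<in>window n. \<bar>\<phi> k - \<phi> (centre n)\<bar> \<le> \<epsilon> * \<phi> (centre n)) sequentially"
  using slow_window[OF assms(1,2)] eventually_ge_at_top[of 1]
proof eventually_elim
  case (elim n)
  show ?case
  proof
    fix k assume k: "k \<in> window n"
    define x where "x = \<phi> (centre n)"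
    define y where "y = \<phi> k"
    have *: "0 < y" "y \<le> (1 + \<epsilon>) * x" "0 < x" "x \<le> (1 + \<epsilon>) * y"
      unfolding x_def y_def using elim k centre_in_window[OF elim(2)] by blast+
    have "(1 - \<epsilon>) * x \<le> (1 - \<epsilon>) * ((1 + \<epsilon>) * y)"
      using * assms by (intro mult_left_mono) auto
    also have "\<dots> = y - \<epsilon> * \<epsilon> * y"
      by (simp add: algebra_simps)
    also have "\<dots> \<le> y"
      using * by simp
    finally show "\<bar>\<phi> k - \<phi> (centre n)\<bar> \<le> \<epsilon> * \<phi> (centre n)"
      using * by (simp add: algebra_simps abs_le_iff flip: x_def y_def)
  qed
qed

text \<open>
  Inside the window \<open>\<phi>\<close> is nearly equal to its value at the centre; outside, the growth bound on
  \<open>\<phi>\<close> is defeated by \<open>tail_negligible\<close>.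
\<close>

lemma avg_slow:
  assumes "slow \<phi>" and large: "eventually (\<lambda>n. 1 \<le> \<phi> n) sequentially"
    and bound: "eventually (\<lambda>n. \<forall>k\<le>n. \<bar>\<phi> k\<bar> \<le> real n ^ 2 * (m n)\<^sup>2) sequentially"
  shows "(\<lambda>n. avg n \<phi>) \<sim>[sequentially] (\<lambda>n. \<phi> (centre n))"
proof (rule asymp_equiv_by_relative_error)
  fix \<epsilon> :: real assume \<epsilon>: "0 < \<epsilon>"
  define \<delta> where "\<delta> = min 1 (\<epsilon> / 2)"
  have \<delta>: "0 < \<delta>" "\<delta> \<le> 1" "\<delta> \<le> \<epsilon> / 2"
    using \<epsilon> by (auto simp: \<delta>_def)
  have "eventually (\<lambda>n::nat. 2 / real n ^ 2 \<le> \<epsilon> / 2) sequentially"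
    using \<epsilon> by real_asymp
  then show "eventually (\<lambda>n. \<bar>avg n \<phi> - \<phi> (centre n)\<bar> \<le> \<epsilon> * \<bar>\<phi> (centre n)\<bar>) sequentially"
    using slow_window_centre[OF assms(1) \<delta>(1,2)] tail_negligible bound
      eventually_compose_filterlim[OF large centre_at_top] eventually_ge_at_top[of 1]
  proof eventually_elim
    case (elim n)
    let ?c = "\<phi> (centre n)"
    let ?b = "real n ^ 2 * (m n)\<^sup>2"
    have c: "centre n \<le> n"
      using centre_in_window[OF elim(6)] by (simp add: window_def)
    have "avg n \<phi> - ?c = (\<Sum>k\<le>n. weight n k * (\<phi> k - ?c))"
      using avg_diff[of n \<phi> "\<lambda>_. ?c"] by (simp add: avg_const avg_def)
    also have "\<dots> = (\<Sum>k\<in>window n. weight n k * (\<phi> k - ?c)) + (\<Sum>k\<in>{..n} - window n. weight n k * (\<phi> k - ?c))"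
      by (subst sum.subset_diff[of "window n"]) (auto simp: window_def)
    finally have "\<bar>avg n \<phi> - ?c\<bar> = \<bar>(\<Sum>k\<in>window n. weight n k * (\<phi> k - ?c))
        + (\<Sum>k\<in>{..n} - window n. weight n k * (\<phi> k - ?c))\<bar>"
      by (rule arg_cong)
    also have "\<dots> \<le> (\<Sum>k\<in>window n. weight n k * (\<delta> * ?c)) + (\<Sum>k\<in>{..n} - window n. weight n k * (2 * ?b))"
    proof (rule order_trans[OF abs_triangle_ineq], rule add_mono; rule order_trans[OF sum_abs], rule sum_mono)
      fix k assume "k \<in> window n"
      then show "\<bar>weight n k * (\<phi> k - ?c)\<bar> \<le> weight n k * (\<delta> * ?c)"
        using elim(2) by (auto simp: abs_mult weight_nonneg intro!: mult_left_mono)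
    next
      fix k assume k: "k \<in> {..n} - window n"
      have "\<bar>\<phi> k - ?c\<bar> \<le> \<bar>\<phi> k\<bar> + \<bar>?c\<bar>"
        by (rule abs_triangle_ineq4)
      also have "\<dots> \<le> 2 * ?b"
        using elim(4)[rule_format, of k] elim(4)[rule_format, OF c] k by simp
      finally show "\<bar>weight n k * (\<phi> k - ?c)\<bar> \<le> weight n k * (2 * ?b)"
        by (auto simp: abs_mult weight_nonneg intro!: mult_left_mono)
    qed
    finally have split: "\<bar>avg n \<phi> - ?c\<bar> \<le> (\<Sum>k\<in>window n. weight n k * (\<delta> * ?c))
        + (\<Sum>k\<in>{..n} - window n. weight n k * (2 * ?b))" .
    have "(\<Sum>k\<in>window n. weight n k * (\<delta> * ?c)) \<le> (\<Sum>k\<le>n. weight n k * (\<delta> * ?c))"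
      using \<delta> elim(5) by (intro sum_mono2) (auto simp: window_def weight_nonneg)
    also have "\<dots> = \<delta> * ?c"
      using avg_const[of n "\<delta> * ?c"] by (simp only: avg_def)
    finally have inner: "(\<Sum>k\<in>window n. weight n k * (\<delta> * ?c)) \<le> \<delta> * ?c" .
    have "(\<Sum>k\<in>{..n} - window n. weight n k * (2 * ?b)) = 2 * (tail n * ?b)"
      unfolding tail_def by (subst sum_distrib_right[symmetric]) simp
    then have "\<bar>avg n \<phi> - ?c\<bar> \<le> \<delta> * ?c + \<epsilon> / 2"
      using split inner elim(1,3) by linarith
    also have "\<dots> \<le> \<epsilon> / 2 * ?c + \<epsilon> / 2 * ?c"
      using \<delta> \<epsilon> elim(5) by (intro add_mono mult_right_mono) auto
    finally show ?case
      using elim(5) by (simp add: algebra_simps)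
  qed
qed

lemma d_equiv: "d \<sim>[sequentially] (\<lambda>n. m (centre n))"
proof -
  have *: "(\<lambda>n. avg n m) \<sim>[sequentially] (\<lambda>n. m (centre n))"
  proof (rule avg_slow[OF slow_m])
    show "eventually (\<lambda>n. 1 \<le> m n) sequentially"
      using eventually_ge_at_top[of 1] by eventually_elim (rule m_ge_1)
    show "eventually (\<lambda>n. \<forall>k\<le>n. \<bar>m k\<bar> \<le> real n ^ 2 * (m n)\<^sup>2) sequentially"
      using eventually_ge_at_top[of 1]
    proof eventually_elim
      case (elim n)
      have "m n * 1 \<le> m n * (m n * real n ^ 2)"
        using m_ge_1[OF elim] elim by (intro mult_left_mono mult_ge1_I) auto
      then show ?case
        using mono_m[of _ n] m_nonneg by (auto simp: power2_eq_square mult_ac intro: order_trans)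
    qed
  qed
  have "eventually (\<lambda>n. avg n m = d n) sequentially"
    using eventually_ge_at_top[of 1] by eventually_elim (simp add: d_eq_avg)
  then show ?thesis
    using * asymp_equiv_cong[of "\<lambda>n. avg n m" d sequentially "\<lambda>n. m (centre n)" "\<lambda>n. m (centre n)"]
    by simp
qed

lemma binomial_variance: "avg n (\<lambda>k. real k * real k) - avg n real * avg n real = real n * p * q"
proof -
  have 1: "avg n real = real n * q" for n
    using avg_absorb[of n "\<lambda>_. 1"] by (simp add: avg_const)
  have "avg n (\<lambda>k. real k * real k) = real n * q * (real (n - 1) * q + 1)"
    unfolding avg_absorb using avg_add[of "n - 1" real "\<lambda>_. 1"] by (simp add: avg_const 1 add.commute)
  then have "avg n (\<lambda>k. real k * real k) - avg n real * avg n real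
      = real n * q * (real (n - 1) * q + 1 - real n * q)"
    by (simp add: 1 algebra_simps)
  also have "\<dots> = real n * p * q"
    by (cases n) (simp_all add: one_minus_q[symmetric] algebra_simps)
  finally show ?thesis .
qed

lemma m_difference_window:
  assumes "\<And>i. i \<in> window n \<Longrightarrow> \<bar>d i - D\<bar> \<le> \<delta> * D"
    and "j \<in> window n" "k \<in> window n" "j \<le> k"
  shows "\<bar>(m k - m j) - D * (real k - real j)\<bar> \<le> \<delta> * D * (real k - real j)"
proof -
  have "l \<le> k \<Longrightarrow> \<bar>(m l - m j) - D * (real l - real j)\<bar> \<le> \<delta> * D * (real l - real j)" if "j \<le> l" for l
    using that
  proof (induction l rule: dec_induct)
    case (step i)
    have "i \<in> window n"
      using assms(2,3) step by (auto simp: window_def)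
    then have "\<bar>d i - D\<bar> \<le> \<delta> * D"
      by (rule assms)
    then show ?case
      using step by (simp add: d_def algebra_simps)
  qed simp
  then show ?thesis
    using assms(4) by simp
qed

text \<open>
  In \<open>2 T n = E (m(B) - m(B'))\<^sup>2\<close>, with \<open>B\<close> and \<open>B'\<close> independent copies of \<open>B\<^sub>n\<close>, the difference is
  \<open>d (centre n) (B - B')\<close> up to a factor close to one as long as both copies lie in the window, and
  \<open>E (B - B')\<^sup>2 = 2 n p q\<close>. Outside the window both sides are at most \<open>n\<^sup>2 m(n)\<^sup>2\<close>.
\<close>

lemma T_equiv: "T \<sim>[sequentially] (\<lambda>n. real n * p * q * (d (centre n))\<^sup>2)"
proof (rule asymp_equiv_by_relative_error)
  fix \<epsilon> :: real assume \<epsilon>: "0 < \<epsilon>"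
  define \<delta> where "\<delta> = min 1 (\<epsilon> / 6)"
  have \<delta>: "0 < \<delta>" "\<delta> \<le> 1" "\<delta> \<le> \<epsilon> / 6"
    using \<epsilon> by (auto simp: \<delta>_def)
  have "eventually (\<lambda>n::nat. 4 / real n ^ 2 \<le> \<epsilon> * (real n * p * q * q\<^sup>2)) sequentially"
    using \<epsilon> p_pos q_pos by real_asymp
  then show "eventually (\<lambda>n. \<bar>T n - real n * p * q * (d (centre n))\<^sup>2\<bar>
      \<le> \<epsilon> * \<bar>real n * p * q * (d (centre n))\<^sup>2\<bar>) sequentially"
    using slow_window_centre[OF slow_d \<delta>(1,2)] tail_negligible eventually_ge_at_top[of 1]
      eventually_compose_filterlim[OF eventually_ge_at_top[of 1] centre_at_top]
  proof eventually_elim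
    case (elim n)
    define D where "D = d (centre n)"
    have c: "centre n \<le> n"
      using centre_in_window[OF elim(4)] by (simp add: window_def)
    have D: "0 < D" "q \<le> D" "D \<le> m n"
      using d_pos d_ge_q mono_d[OF elim(5) c] d_le_m[OF elim(4)] by (auto simp: D_def)
    let ?w = "weight n"
    define b where "b = (real n)\<^sup>2 * (m n)\<^sup>2"
    \<comment> \<open>Marks the complement of the window, so that one estimate covers all pairs \<open>j\<close>, \<open>k\<close>.\<close>
    define ind where "ind k = (if k \<in> window n then 0 else 1 :: real)" for k
    have pointwise: "\<bar>(m j - m k)\<^sup>2 - D\<^sup>2 * (real j - real k)\<^sup>2\<bar>
        \<le> 3 * \<delta> * (D\<^sup>2 * (real j - real k)\<^sup>2) + 2 * b * (ind j + ind k)" if "j \<le> n" "k \<le> n" for j k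
    proof (cases "j \<in> window n \<and> k \<in> window n")
      case True
      define x where "x = \<bar>m j - m k\<bar>"
      define y where "y = \<bar>real j - real k\<bar>"
      have "\<bar>x - D * y\<bar> \<le> \<delta> * (D * y)"
      proof (cases "j \<le> k")
        case jk: True
        then show ?thesis
          using m_difference_window[of n D \<delta> j k] elim(2) True mono_m[of j k]
          by (simp add: x_def y_def D_def abs_minus_commute mult.assoc)
      next
        case jk: False
        then show ?thesis
          using m_difference_window[of n D \<delta> k j] elim(2) True mono_m[of k j]
          by (simp add: x_def y_def D_def mult.assoc)
      qed
      moreover have y: "0 \<le> D * y"
        using D by (simp add: y_def)
      ultimately have 1: "\<bar>x - D * y\<bar> * \<bar>x + D * y\<bar> \<le> (\<delta> * (D * y)) * (3 * (D * y))"
        using \<delta> mult_right_mono[OF \<delta>(2) y] by (intro mult_mono) (auto simp: x_def)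
      have "\<bar>x\<^sup>2 - (D * y)\<^sup>2\<bar> \<le> 3 * \<delta> * (D * y)\<^sup>2"
      proof -
        have "x\<^sup>2 - (D * y)\<^sup>2 = (x - D * y) * (x + D * y)"
          by (simp add: power2_eq_square algebra_simps)
        then show ?thesis
          using 1 by (simp add: abs_mult power2_eq_square mult_ac)
      qed
      then show ?thesis
        using True by (simp add: x_def y_def ind_def power_mult_distrib)
    next
      case False
      then have ind: "1 \<le> ind j + ind k"
        by (auto simp: ind_def)
      have "(m j - m k)\<^sup>2 \<le> (m n)\<^sup>2"
        using mono_m[of _ n] m_nonneg that by (subst abs_le_square_iff[symmetric]) (smt (verit))
      also have "\<dots> \<le> b"
        using elim(4) mult_right_mono[of 1 "(real n)\<^sup>2" "(m n)\<^sup>2"] by (simp add: b_def)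
      finally have 1: "(m j - m k)\<^sup>2 \<le> b" .
      have "(real j - real k)\<^sup>2 \<le> (real n)\<^sup>2"
        using that by (subst abs_le_square_iff[symmetric]) auto
      then have 2: "D\<^sup>2 * (real j - real k)\<^sup>2 \<le> b"
        unfolding b_def mult.commute[of "D\<^sup>2"] using D by (intro mult_mono power_mono[of D]) auto
      have "\<bar>(m j - m k)\<^sup>2 - D\<^sup>2 * (real j - real k)\<^sup>2\<bar> \<le> 2 * b"
        using 1 2 abs_triangle_ineq4[of "(m j - m k)\<^sup>2" "D\<^sup>2 * (real j - real k)\<^sup>2"] by simp
      also have "\<dots> \<le> 2 * b * (ind j + ind k)"
        using ind mult_left_mono[OF ind, of "2 * b"] by (simp add: b_def)
      finally show ?thesis
        using \<delta> by (simp add: add_increasing)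
    qed
    have sum_ind: "(\<Sum>k\<le>n. ?w k * ind k) = tail n"
      unfolding tail_def ind_def by (rule sum.mono_neutral_cong_right) auto
    have T2: "2 * T n = (\<Sum>j\<le>n. \<Sum>k\<le>n. ?w j * ?w k * (m j - m k)\<^sup>2)"
      using avg_covariance[of n m m] by (simp add: T_def power2_eq_square)
    have N2: "2 * (real n * p * q * D\<^sup>2) = (\<Sum>j\<le>n. \<Sum>k\<le>n. ?w j * ?w k * (D\<^sup>2 * (real j - real k)\<^sup>2))"
    proof -
      have "(\<Sum>j\<le>n. \<Sum>k\<le>n. ?w j * ?w k * (D\<^sup>2 * (real j - real k)\<^sup>2))
          = D\<^sup>2 * (\<Sum>j\<le>n. \<Sum>k\<le>n. ?w j * ?w k * ((real j - real k) * (real j - real k)))"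
        by (simp add: sum_distrib_left power2_eq_square mult_ac)
      then show ?thesis
        using avg_covariance[of n real real] by (simp add: binomial_variance)
    qed
    have "\<bar>2 * T n - 2 * (real n * p * q * D\<^sup>2)\<bar>
        = \<bar>\<Sum>j\<le>n. \<Sum>k\<le>n. ?w j * ?w k * ((m j - m k)\<^sup>2 - D\<^sup>2 * (real j - real k)\<^sup>2)\<bar>"
      unfolding T2 N2 by (simp add: right_diff_distrib sum_subtractf)
    also have "\<dots> \<le> (\<Sum>j\<le>n. \<Sum>k\<le>n. ?w j * ?w k *
        (3 * \<delta> * (D\<^sup>2 * (real j - real k)\<^sup>2) + 2 * b * (ind j + ind k)))"
    proof (rule order_trans[OF sum_abs], rule sum_mono, rule order_trans[OF sum_abs], rule sum_mono)
      fix j k assume "j \<in> {..n}" "k \<in> {..n}"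
      then show "\<bar>?w j * ?w k * ((m j - m k)\<^sup>2 - D\<^sup>2 * (real j - real k)\<^sup>2)\<bar>
          \<le> ?w j * ?w k * (3 * \<delta> * (D\<^sup>2 * (real j - real k)\<^sup>2) + 2 * b * (ind j + ind k))"
        unfolding abs_mult using weight_nonneg by (intro mult_mono pointwise) auto
    qed
    also have "\<dots> = 3 * \<delta> * (\<Sum>j\<le>n. \<Sum>k\<le>n. ?w j * ?w k * (D\<^sup>2 * (real j - real k)\<^sup>2))
        + 2 * b * ((\<Sum>j\<le>n. \<Sum>k\<le>n. (?w j * ind j) * ?w k) + (\<Sum>j\<le>n. \<Sum>k\<le>n. ?w j * (?w k * ind k)))"
      by (simp only: distrib_left sum.distrib sum_distrib_left mult_ac)
    also have "\<dots> = 3 * \<delta> * (2 * (real n * p * q * D\<^sup>2)) + 4 * (tail n * b)"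
      by (simp only: N2 sum_product[symmetric] sum_weight sum_ind) simp
    finally have "\<bar>2 * T n - 2 * (real n * p * q * D\<^sup>2)\<bar>
        \<le> 3 * \<delta> * (2 * (real n * p * q * D\<^sup>2)) + 4 * (tail n * b)" .
    moreover have "4 * (tail n * b) \<le> \<epsilon> * (real n * p * q * q\<^sup>2)"
      using elim(1,3) unfolding b_def by linarith
    moreover have "\<epsilon> * (real n * p * q * q\<^sup>2) \<le> \<epsilon> * (real n * p * q * D\<^sup>2)"
      using \<epsilon> p_pos q_pos D by (intro mult_left_mono power_mono mult_nonneg_nonneg) auto
    moreover have "3 * \<delta> * (2 * (real n * p * q * D\<^sup>2)) \<le> \<epsilon> * (real n * p * q * D\<^sup>2)"
      using \<delta> p_pos q_pos mult_right_mono[of "6 * \<delta>" \<epsilon> "real n * p * q * D\<^sup>2"] by simp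
    ultimately have "\<bar>T n - real n * p * q * D\<^sup>2\<bar> \<le> \<epsilon> * (real n * p * q * D\<^sup>2)"
      by linarith
    then show ?case
      using p_pos q_pos by (simp add: D_def abs_mult)
  qed
qed

end

section \<open>The logarithmic growth rate of the mean\<close>

context thinning
begin

definition rho :: "nat \<Rightarrow> real" where
  "rho n = real n * d n / m n"

lemma rho_pos: "1 \<le> n \<Longrightarrow> 0 < rho n"
  using m_pos[of n] d_pos[of n] by (simp add: rho_def)

lemma rho_le:
  assumes "d n \<le> H A c n * m n" "1 \<le> n" "0 \<le> c" "0 \<le> A"
  shows "rho n \<le> A + c * ln (real n + 1)"
proof -
  have "real n * d n \<le> (real n + 1) * (H A c n * m n)"
    using assms d_nonneg by (intro mult_mono) auto
  then have "rho n \<le> (real n + 1) * H A c n"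
    using m_pos[OF assms(2)] by (simp add: rho_def divide_le_eq mult_ac)
  then show ?thesis
    by (simp add: H_def)
qed

lemma d_eq_rho: "1 \<le> n \<Longrightarrow> d n = rho n * m n / real n"
  using m_pos[of n] by (simp add: rho_def)

text \<open>
  The weighted average of \<open>d / m\<close> with weights \<open>m\<close> is bounded below by its values on the window,
  because the window carries almost all of the mass \<open>E m(B\<^sub>n) = d n\<close>.
\<close>

lemma avg_d_window_ge:
  assumes "1 \<le> n" "tail n * ((real n)\<^sup>2 * (m n)\<^sup>2) \<le> 1 / (real n)\<^sup>2" "0 \<le> G"
    and "\<And>j. j \<in> window n \<Longrightarrow> G * m j \<le> d j"
  shows "G * (d n * (1 - 1 / (q * (real n)\<^sup>2))) \<le> avg n d"
proof -
  have "1 * tail n \<le> (real n)\<^sup>2 * tail n"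
    using assms(1) tail_nonneg by (intro mult_right_mono) auto
  moreover have "m n * 1 \<le> m n * m n"
    using m_ge_1[OF assms(1)] by (intro mult_left_mono) auto
  ultimately have "tail n * m n \<le> ((real n)\<^sup>2 * tail n) * (m n * m n)"
    using tail_nonneg m_nonneg by (intro mult_mono) auto
  also have "\<dots> = tail n * ((real n)\<^sup>2 * (m n)\<^sup>2)"
    by (simp add: power2_eq_square)
  finally have "tail n * m n \<le> 1 / (real n)\<^sup>2"
    using assms(2) by linarith
  also have "\<dots> \<le> d n * (1 / (q * (real n)\<^sup>2))"
    using d_ge_q[of n] q_pos assms(1) by (simp add: field_simps)
  finally have t: "tail n * m n \<le> d n * (1 / (q * (real n)\<^sup>2))" .
  have "d n = avg n m"
    by (rule d_eq_avg[OF assms(1)])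
  also have "\<dots> = (\<Sum>k\<in>window n. weight n k * m k) + (\<Sum>k\<in>{..n} - window n. weight n k * m k)"
    unfolding avg_def by (subst sum.subset_diff[of "window n"]) (auto simp: window_def)
  finally have split: "d n = (\<Sum>k\<in>window n. weight n k * m k) + (\<Sum>k\<in>{..n} - window n. weight n k * m k)" .
  have "(\<Sum>k\<in>{..n} - window n. weight n k * m k) \<le> (\<Sum>k\<in>{..n} - window n. weight n k * m n)"
    by (intro sum_mono mult_left_mono mono_m weight_nonneg) auto
  also have "\<dots> = tail n * m n"
    unfolding tail_def by (subst sum_distrib_right[symmetric]) simp
  finally have "d n * (1 - 1 / (q * (real n)\<^sup>2)) \<le> (\<Sum>k\<in>window n. weight n k * m k)"
    using t split by (simp add: right_diff_distrib)
  then have "G * (d n * (1 - 1 / (q * (real n)\<^sup>2))) \<le> G * (\<Sum>k\<in>window n. weight n k * m k)"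
    using assms(3) by (rule mult_left_mono)
  also have "\<dots> = (\<Sum>k\<in>window n. weight n k * (G * m k))"
    unfolding sum_distrib_left by (intro sum.cong) auto
  also have "\<dots> \<le> (\<Sum>k\<in>window n. weight n k * d k)"
    using assms(4) by (intro sum_mono mult_left_mono weight_nonneg)
  also have "\<dots> \<le> avg n d"
    unfolding avg_def using d_nonneg weight_nonneg by (intro sum_mono2) (auto simp: window_def)
  finally show ?thesis .
qed

text \<open>
  The logarithmic barrier \<open>a ln n - b\<close> with \<open>a < 1 / lam\<close> propagates by one step: a lower bound for
  \<open>\<rho>\<close> on the window around \<open>q n\<close> bounds the relative growth of \<open>d\<close> from below, and \<open>barrier_algebra\<close>
  compares the result with the barrier at the next index. The threshold \<open>n0\<close> depends only on the
  upper limit \<open>a1\<close> for \<open>a\<close>, and not on \<open>b\<close>; this uniformity is what \<open>rho_at_top\<close> exploits.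
\<close>

lemma rho_lower_step:
  assumes a1: "0 < a1" "a1 * lam < 1"
  obtains n0 K where "0 < K"
    "\<And>a b N. 0 < a \<Longrightarrow> a \<le> a1 \<Longrightarrow> n0 \<le> N \<Longrightarrow>
       (\<And>j. j \<in> window N \<Longrightarrow> K * a \<le> a * ln (real j) - b \<and> a * ln (real j) - b \<le> rho j) \<Longrightarrow>
       a * ln (real N) - b \<le> rho N \<Longrightarrow>
       a * ln (real (Suc N)) - b \<le> rho (Suc N)"
proof -
  define \<theta> where "\<theta> = 1 - a1 * lam"
  have \<theta>: "0 < \<theta>"
    using a1 by (simp add: \<theta>_def)
  define K where "K = 4 / \<theta> + lam + 1"
  have K: "0 < K" "1 \<le> K" "lam \<le> K" "4 / \<theta> \<le> K"
    using \<theta> lam_pos divide_pos_pos[of 4 \<theta>] unfolding K_def by linarith+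
  obtain A where A: "4 / lam \<le> A" "\<And>n. 1 \<le> n \<Longrightarrow> d n \<le> H A (4 / lam) n * m n"
    using d_le_H_crude by blast
  define c where "c = 4 / lam"
  have c: "0 < c" "0 \<le> A"
    using lam_pos A(1) by (auto simp: c_def intro: order_trans[of 0 "4 / lam"])
  \<comment> \<open>The first term accounts for the width of the window, the second for the mass outside of it.\<close>
  define \<sigma> where "\<sigma> n = real n powr (-1/3) / q + 1 / (q * (real n)\<^sup>2)" for n :: nat
  have "eventually (\<lambda>n. \<sigma> n * (A + c * ln (real n + 1)) \<le> \<theta> / 4) sequentially"
    unfolding \<sigma>_def using \<theta> c q_pos by real_asymp
  moreover have "eventually (\<lambda>n::nat. 1 + a1 \<le> real n * \<theta> / 2) sequentially"
    using \<theta> by real_asymp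
  moreover have "eventually (\<lambda>n::nat. real n powr (-1/3) / q \<le> 1) sequentially"
    using q_pos by real_asymp
  moreover have "eventually (\<lambda>n::nat. 1 / (q * (real n)\<^sup>2) \<le> 1) sequentially"
    using q_pos by real_asymp
  moreover note tail_negligible eventually_ge_at_top[of 1] window_ge
  moreover have "eventually (\<lambda>n::nat. 1 \<le> real n * q / 2) sequentially"
    using q_pos by real_asymp
  ultimately have "eventually (\<lambda>n. \<sigma> n * (A + c * ln (real n + 1)) \<le> \<theta> / 4 \<and>
      1 + a1 \<le> real n * \<theta> / 2 \<and> real n powr (-1/3) / q \<le> 1 \<and> 1 / (q * (real n)\<^sup>2) \<le> 1 \<and>
      tail n * ((real n)\<^sup>2 * (m n)\<^sup>2) \<le> 1 / (real n)\<^sup>2 \<and> 1 \<le> n \<and>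
      (\<forall>k\<in>window n. 1 \<le> real k)) sequentially"
    by eventually_elim force
  then obtain n0 where n0: "\<And>n. n0 \<le> n \<Longrightarrow> \<sigma> n * (A + c * ln (real n + 1)) \<le> \<theta> / 4 \<and>
      1 + a1 \<le> real n * \<theta> / 2 \<and> real n powr (-1/3) / q \<le> 1 \<and> 1 / (q * (real n)\<^sup>2) \<le> 1 \<and>
      tail n * ((real n)\<^sup>2 * (m n)\<^sup>2) \<le> 1 / (real n)\<^sup>2 \<and> 1 \<le> n \<and>
      (\<forall>k\<in>window n. 1 \<le> real k)"
    unfolding eventually_sequentially by auto
  show thesis
  proof (rule that[OF K(1), of n0])
    fix a b N
    assume a: "0 < a" "a \<le> a1" and N: "n0 \<le> N"
      and win: "\<And>j. j \<in> window N \<Longrightarrow> K * a \<le> a * ln (real j) - b \<and> a * ln (real j) - b \<le> rho j"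
      and rN: "a * ln (real N) - b \<le> rho N"
    note n0 = n0[OF N]
    have N1: "1 \<le> N"
      using n0 by blast
    define g where "g = a * ln (real N) - b"
    \<comment> \<open>The right end of the window, where the barrier divided by \<open>j\<close> is smallest.\<close>
    define y where "y = real N * q + real N powr (2/3)"
    have y: "0 < y" "real N * q \<le> y"
      using N1 q_pos by (auto simp: y_def add_pos_nonneg)
    have cw: "centre N \<in> window N"
      by (rule centre_in_window[OF N1])
    then have cN: "1 \<le> real (centre N)" "centre N \<le> N"
      using n0 by (auto simp: window_def)
    have "K * a \<le> a * ln (real (centre N)) - b"
      using win[OF cw] by blast
    also have "\<dots> \<le> g"
      using a cN by (simp add: g_def)
    finally have g: "K * a \<le> g" .
    have lam_g: "a * lam \<le> g"
    proof -
      have "lam * a \<le> K * a"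
        using K(3) a by (intro mult_right_mono) auto
      then show ?thesis
        using g unfolding mult.commute[of a lam] by linarith
    qed
    have \<theta>_g: "4 * a \<le> \<theta> * g"
    proof -
      have "4 \<le> \<theta> * K"
        using K(4) \<theta> by (simp add: field_simps)
      then have "4 * a \<le> \<theta> * K * a"
        using a by (intro mult_right_mono) auto
      also have "\<dots> = \<theta> * (K * a)"
        by (rule mult.assoc)
      also have "\<dots> \<le> \<theta> * g"
        using g \<theta> by (intro mult_left_mono) auto
      finally show ?thesis .
    qed
    have g_pos: "0 < g"
      using g mult_pos_pos[OF K(1) a(1)] by linarith
    have \<sigma>: "0 \<le> \<sigma> N"
      using q_pos by (simp add: \<sigma>_def)
    have "g \<le> A + c * ln (real N + 1)"
      using rN rho_le[OF A(2)[OF N1] N1] c by (simp add: g_def c_def)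
    then have \<sigma>_g: "\<sigma> N * g \<le> \<theta> / 4"
      using mult_left_mono[OF _ \<sigma>] n0 by fastforce
    define G where "G = (a * ln y - b) / y"
    have ln_y: "g - a * lam \<le> a * ln y - b"
    proof -
      have "ln (real N * q) \<le> ln y"
        using y N1 q_pos by (subst ln_le_cancel_iff) auto
      moreover have "ln (real N * q) = ln (real N) - lam"
        using N1 q_pos by (simp add: ln_mult lam_def)
      ultimately have "a * (ln (real N) - lam) \<le> a * ln y"
        using a by (intro mult_left_mono) auto
      then show ?thesis
        by (simp add: g_def algebra_simps)
    qed
    have G0: "0 \<le> G"
      using ln_y lam_g y by (simp add: G_def)
    have "G * (d N * (1 - 1 / (q * (real N)\<^sup>2))) \<le> avg N d"
    proof (rule avg_d_window_ge[OF N1 _ G0])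
      fix j assume j: "j \<in> window N"
      have j1: "1 \<le> real j"
        using n0 j by blast
      have "a \<le> K * a"
        using K(2) a mult_right_mono[of 1 K a] by simp
      then have "a \<le> a * ln (real j) - b"
        using win[OF j] by linarith
      moreover have "real j \<le> y"
        using j by (auto simp: window_def y_def)
      ultimately have "G \<le> (a * ln (real j) - b) / real j"
        unfolding G_def using j1 a by (intro log_over_linear_antimono) auto
      also have "\<dots> \<le> rho j / real j"
        using win[OF j] j1 by (intro divide_right_mono) auto
      finally have "G * m j \<le> rho j / real j * m j"
        using m_nonneg by (intro mult_right_mono)
      then show "G * m j \<le> d j"
        using j1 d_eq_rho[of j] by simp
    qed (use n0 in blast)
    then have "q * (G * (d N * (1 - 1 / (q * (real N)\<^sup>2)))) \<le> q * avg N d"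
      using q_pos by (intro mult_left_mono) auto
    then have d1: "d N + q * (G * (d N * (1 - 1 / (q * (real N)\<^sup>2)))) \<le> d (Suc N)"
      using d_Suc[OF N1] by linarith
    define s where "s = real N powr (-1/3) / q"
    define t where "t = 1 / (q * (real N)\<^sup>2)"
    have st: "0 \<le> s" "0 \<le> t" "s \<le> 1" "t \<le> 1" "\<sigma> N = s + t"
      using n0 q_pos by (auto simp: s_def t_def \<sigma>_def)
    have qy: "(1 - s) / real N \<le> q / y"
    proof -
      have "real N powr (2/3) = real N * real N powr (-1/3)"
        using N1 powr_add[of "real N" 1 "-1/3"] by simp
      then have y_eq: "y = real N * q * (1 + s)"
        using q_pos by (simp add: y_def s_def field_simps)
      have "(1 - s) * (1 + s) \<le> 1"
        by (simp add: algebra_simps)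
      then have "(1 - s) * y \<le> q * real N"
        using mult_left_mono[of "(1 - s) * (1 + s)" 1 "real N * q"] q_pos by (simp add: y_eq mult_ac)
      then show ?thesis
        using y N1 by (simp add: field_simps)
    qed
    have "(1 - \<sigma> N) * (g - a * lam) / real N \<le> q * G * (1 - t)"
    proof -
      have "1 - \<sigma> N \<le> (1 - s) * (1 - t)"
        using st by (simp add: algebra_simps)
      then have "(1 - \<sigma> N) * (g - a * lam) / real N \<le> (1 - s) * (1 - t) * (g - a * lam) / real N"
        using lam_g by (intro divide_right_mono mult_right_mono) auto
      also have "\<dots> = (1 - s) / real N * ((g - a * lam) * (1 - t))"
        by simp
      also have "\<dots> \<le> q / y * ((a * ln y - b) * (1 - t))"
        using qy ln_y lam_g st y q_pos by (intro mult_mono mult_right_mono) auto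
      also have "\<dots> = q * G * (1 - t)"
        by (simp add: G_def)
      finally show ?thesis .
    qed
    then have "d N * (1 + (1 - \<sigma> N) * (g - a * lam) / real N) \<le> d N * (1 + q * G * (1 - t))"
      using d_nonneg by (intro mult_left_mono add_left_mono)
    also have "\<dots> \<le> d (Suc N)"
      using d1[folded t_def] by (simp add: algebra_simps)
    finally have d2: "d N * (1 + (1 - \<sigma> N) * (g - a * lam) / real N) \<le> d (Suc N)" .
    define E where "E = 1 + (1 - \<sigma> N) * (g - a * lam) / real N"
    have \<sigma>1: "\<sigma> N \<le> 2"
      using st by simp
    have bar: "g + a / real N \<le> (real N + 1) * E * (g / (real N + g))"
      unfolding E_def
    proof (rule barrier_algebra)
      show "a * lam \<le> 1 - \<theta>"
        using a lam_pos by (simp add: \<theta>_def)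
      show "1 + a \<le> real N * \<theta> / 2"
        using n0 a by linarith
    qed (use N1 g_pos a \<theta> \<sigma> lam_pos \<sigma>_g \<theta>_g in auto)
    have E: "0 < E"
    proof (rule ccontr)
      assume "\<not> 0 < E"
      then have "(real N + 1) * E * (g / (real N + g)) \<le> 0"
        using g_pos by (intro mult_nonpos_nonneg mult_nonneg_nonpos) auto
      then show False
        using bar g_pos divide_nonneg_nonneg[of a "real N"] a(1) of_nat_0_le_iff[of N] by linarith
    qed
    have gr: "g / (real N + g) \<le> rho N / (real N + rho N)"
      using rN g_pos N1 rho_pos[OF N1] by (simp add: g_def[symmetric] divide_simps) (simp add: algebra_simps)
    have "ln (real (Suc N)) - ln (real N) \<le> 1 / real N"
    proof -
      have "ln (real (Suc N)) - ln (real N) = ln (1 + 1 / real N)"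
      proof -
        have "1 + 1 / real N = real (Suc N) / real N"
          using N1 by (simp add: field_simps)
        then show ?thesis
          using N1 by (simp only: ln_divide_pos of_nat_0_less_iff zero_less_Suc)
      qed
      also have "\<dots> \<le> 1 / real N"
        by (rule ln_add_one_self_le_self) simp
      finally show ?thesis .
    qed
    then have "a * (ln (real (Suc N)) - ln (real N)) \<le> a * (1 / real N)"
      using a by (intro mult_left_mono) auto
    then have "a * ln (real (Suc N)) - b \<le> g + a / real N"
      by (simp add: g_def algebra_simps)
    also note bar
    also have "(real N + 1) * E * (g / (real N + g)) \<le> (real N + 1) * E * (rho N / (real N + rho N))"
      using E gr by (intro mult_left_mono) auto
    also have "\<dots> = (real N + 1) * (d N * E) / (m N + d N)"
    proof -
      have mN: "0 < m N"
        by (rule m_pos[OF N1])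
      have "rho N / (real N + rho N) = d N / (m N + d N)"
      proof -
        have "real N + rho N = real N * (m N + d N) / m N"
          using mN by (simp add: rho_def field_simps)
        then show ?thesis
          using mN N1 d_pos[of N] by (simp only:) (simp add: rho_def)
      qed
      then show ?thesis
        by simp
    qed
    also have "\<dots> \<le> (real N + 1) * d (Suc N) / (m N + d N)"
      using d2 m_nonneg d_nonneg by (intro divide_right_mono mult_left_mono) (auto simp: E_def)
    also have "\<dots> = rho (Suc N)"
      by (simp add: rho_def d_def[of N] add.commute)
    finally show "a * ln (real (Suc N)) - b \<le> rho (Suc N)" .
  qed
qed

lemma le_divide_q: "real n \<le> real n / q"
  using q_pos q_less_1 mult_left_le[of q "real n"] by (simp add: field_simps)

text \<open>
  The window of an index beyond \<open>2 N / q\<close> lies above \<open>N\<close>, so an initial stretch of this length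
  suffices to start the induction.
\<close>

lemma rho_lower_barrier:
  assumes a1: "0 < a1" "a1 * lam < 1"
  obtains n0 K where "0 < K"
    "\<And>a b N. 0 < a \<Longrightarrow> a \<le> a1 \<Longrightarrow> n0 \<le> N \<Longrightarrow> K * a \<le> a * ln (real N) - b \<Longrightarrow>
       (\<And>j. N \<le> j \<Longrightarrow> real j \<le> 2 * real N / q + 1 \<Longrightarrow> a * ln (real j) - b \<le> rho j) \<Longrightarrow>
       (\<And>j. N \<le> j \<Longrightarrow> a * ln (real j) - b \<le> rho j)"
proof -
  obtain n1 K where K: "0 < K" and step:
    "\<And>a b N. 0 < a \<Longrightarrow> a \<le> a1 \<Longrightarrow> n1 \<le> N \<Longrightarrow>
       (\<And>j. j \<in> window N \<Longrightarrow> K * a \<le> a * ln (real j) - b \<and> a * ln (real j) - b \<le> rho j) \<Longrightarrow>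
       a * ln (real N) - b \<le> rho N \<Longrightarrow>
       a * ln (real (Suc N)) - b \<le> rho (Suc N)"
    using rho_lower_step[OF a1] by metis
  obtain n2 where n2: "\<And>n. n2 \<le> n \<Longrightarrow> \<forall>k\<in>window n. real n * q / 2 \<le> real k"
    using window_ge unfolding eventually_sequentially by blast
  show thesis
  proof (rule that[OF K, of "max 1 (max n1 n2)"])
    fix a b N j
    assume a: "0 < a" "a \<le> a1" and N: "max 1 (max n1 n2) \<le> N" and KN: "K * a \<le> a * ln (real N) - b"
      and base: "\<And>j. N \<le> j \<Longrightarrow> real j \<le> 2 * real N / q + 1 \<Longrightarrow> a * ln (real j) - b \<le> rho j"
    show "N \<le> j \<Longrightarrow> a * ln (real j) - b \<le> rho j"
    proof (induction j rule: less_induct)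
      case (less j)
      show ?case
      proof (cases "real j \<le> 2 * real N / q + 1")
        case True
        then show ?thesis using base less by blast
      next
        case False
        moreover have "0 \<le> 2 * real N / q"
          using q_pos by simp
        ultimately have "0 < j"
          by (intro Nat.gr0I) auto
        then obtain M where M: "j = Suc M"
          by (cases j) auto
        have MN: "2 * real N / q \<le> real M"
          using False by (simp add: M)
        have "real N \<le> real N / q"
          by (rule le_divide_q)
        then have NM: "N \<le> M"
          using MN by linarith
        show ?thesis
          unfolding M
        proof (rule step[OF a])
          show "n1 \<le> M"
            using N NM by simp
          show "a * ln (real M) - b \<le> rho M"
            using less.IH[of M] NM by (simp add: M)
          fix k assume k: "k \<in> window M"
          have "real M * q / 2 \<le> real k"
            using n2[of M] N NM k by simp
          moreover have "real N \<le> real M * q / 2"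
            using MN q_pos by (simp add: field_simps)
          ultimately have Nk: "N \<le> k"
            by linarith
          moreover have "k \<le> M"
            using k by (simp add: window_def)
          ultimately have "a * ln (real k) - b \<le> rho k"
            using less.IH[of k] by (simp add: M)
          moreover have "a * ln (real N) \<le> a * ln (real k)"
            using Nk N a by simp
          ultimately show "K * a \<le> a * ln (real k) - b \<and> a * ln (real k) - b \<le> rho k"
            using KN by linarith
        qed
      qed
    qed
  qed
qed

text \<open>
  On the initial stretch \<open>\<rho>\<close> is merely positive. A barrier with a sufficiently small slope \<open>a\<close> fits
  below its minimum there while still having height \<open>K a\<close> at the start.
\<close>

lemma rho_at_top: "filterlim rho at_top sequentially"
proof -
  define a1 where "a1 = 1 / (2 * lam)"
  have a1: "0 < a1" "a1 * lam < 1"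
    using lam_pos by (auto simp: a1_def)
  obtain n0 K where K: "0 < K" and barrier:
    "\<And>a b N j. 0 < a \<Longrightarrow> a \<le> a1 \<Longrightarrow> n0 \<le> N \<Longrightarrow> K * a \<le> a * ln (real N) - b \<Longrightarrow>
       (\<And>j. N \<le> j \<Longrightarrow> real j \<le> 2 * real N / q + 1 \<Longrightarrow> a * ln (real j) - b \<le> rho j) \<Longrightarrow>
       N \<le> j \<Longrightarrow> a * ln (real j) - b \<le> rho j"
    using rho_lower_barrier[OF a1] by metis
  define N where "N = max 1 n0"
  define J where "J = {j. N \<le> j \<and> real j \<le> 2 * real N / q + 1}"
  have fin: "finite J"
    by (rule finite_subset[of J "{..nat \<lfloor>2 * real N / q + 1\<rfloor>}"])
      (use le_nat_floor in \<open>unfold J_def, blast, simp\<close>)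
  have "real N \<le> real N / q"
    by (rule le_divide_q)
  then have NJ: "N \<in> J"
    by (auto simp: J_def)
  define \<mu> where "\<mu> = Min (rho ` J)"
  have "\<mu> \<in> rho ` J"
    unfolding \<mu>_def using fin NJ by (intro Min_in) auto
  then have \<mu>: "0 < \<mu>"
    using rho_pos by (force simp: J_def N_def)
  \<comment> \<open>\<open>a * D\<close> bounds the barrier of slope \<open>a\<close> and initial height \<open>K * a\<close> on all of \<open>J\<close>.\<close>
  define D where "D = ln ((2 * real N / q + 1) / real N) + K"
  have "1 \<le> (2 * real N / q + 1) / real N"
    using \<open>real N \<le> real N / q\<close> by (simp add: N_def field_simps)
  then have D: "0 < D"
    using K by (simp add: D_def add_nonneg_pos)
  define a where "a = min a1 (\<mu> / D)"
  have a: "0 < a" "a \<le> a1" "a * D \<le> \<mu>"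
    using a1 \<mu> D by (auto simp: a_def min_def field_simps)
  define b where "b = a * ln (real N) - K * a"
  have "a * ln (real j) - b \<le> rho j" if "N \<le> j" for j
  proof (rule barrier[OF a(1,2) _ _ _ that])
    fix j assume j: "N \<le> j" "real j \<le> 2 * real N / q + 1"
    have N: "0 < real N"
      by (simp add: N_def)
    have "ln (real j) \<le> ln (2 * real N / q + 1)"
      using j N by (intro ln_mono) auto
    also have "\<dots> = ln ((2 * real N / q + 1) / real N) + ln (real N)"
      using N q_pos by (subst ln_div) (auto simp: add_pos_pos add_nonneg_eq_0_iff)
    finally have "a * (ln (real j) - ln (real N) + K) \<le> a * D"
      using a by (intro mult_left_mono) (auto simp: D_def)
    also have "\<dots> \<le> rho j"
      using a(3) fin j by (intro order_trans[OF a(3)]) (auto simp: \<mu>_def J_def)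
    finally show "a * ln (real j) - b \<le> rho j"
      by (simp add: b_def algebra_simps)
  qed (auto simp: N_def b_def)
  then have "eventually (\<lambda>j. a * ln (real j) - b \<le> rho j) sequentially"
    using eventually_sequentially by blast
  moreover have "filterlim (\<lambda>j::nat. a * ln (real j) - b) at_top sequentially"
    using a by real_asymp
  ultimately show ?thesis
    using filterlim_at_top_mono by blast
qed

text \<open>
  Since \<open>\<rho>\<close> diverges, a barrier with any prescribed slope \<open>a < 1 / lam\<close> fits below it on some initial
  stretch, over which the barrier rises only by a constant.
\<close>

lemma rho_eventually_ge:
  assumes a: "0 < a" "a * lam < 1"
  obtains b where "eventually (\<lambda>n. a * ln (real n) - b \<le> rho n) sequentially"
proof -
  obtain n0 K where K: "0 < K" and barrier:
    "\<And>b N j. n0 \<le> N \<Longrightarrow> K * a \<le> a * ln (real N) - b \<Longrightarrow>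
       (\<And>j. N \<le> j \<Longrightarrow> real j \<le> 2 * real N / q + 1 \<Longrightarrow> a * ln (real j) - b \<le> rho j) \<Longrightarrow>
       N \<le> j \<Longrightarrow> a * ln (real j) - b \<le> rho j"
    using rho_lower_barrier[OF a] a(1) order_refl by metis
  define R where "R = a * (ln (2 / q + 1) + K)"
  have "eventually (\<lambda>n. R \<le> rho n) sequentially"
    using rho_at_top by (simp add: filterlim_at_top)
  then obtain N' where N': "\<And>n. N' \<le> n \<Longrightarrow> R \<le> rho n"
    unfolding eventually_sequentially by blast
  define N where "N = max 1 (max n0 N')"
  define b where "b = a * ln (real N) - K * a"
  have N: "1 \<le> real N"
    by (simp add: N_def)
  have "a * ln (real j) - b \<le> rho j" if "N \<le> j" for j
  proof (rule barrier[OF _ _ _ that])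
    fix j assume j: "N \<le> j" "real j \<le> 2 * real N / q + 1"
    have "real j \<le> (2 / q + 1) * real N"
      using j N by (simp add: algebra_simps)
    then have "ln (real j) \<le> ln ((2 / q + 1) * real N)"
      using j N by (intro ln_mono) auto
    also have "\<dots> = ln (2 / q + 1) + ln (real N)"
      using N q_pos by (intro ln_mult_pos) (auto simp: add_pos_pos)
    finally have "a * (ln (real j) - ln (real N) + K) \<le> R"
      unfolding R_def using a by (intro mult_left_mono) auto
    also have "\<dots> \<le> rho j"
      using j by (intro N') (simp add: N_def)
    finally show "a * ln (real j) - b \<le> rho j"
      by (simp add: b_def algebra_simps)
  qed (auto simp: N_def b_def)
  then show thesis
    using that eventually_sequentially by blast
qed

text \<open>
  The upper and the lower barriers have slopes in \<open>ln n\<close> arbitrarily close to \<open>1 / lam\<close> from above and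
  from below, and their constant terms are swamped by the logarithm.
\<close>

theorem rho_equiv: "rho \<sim>[sequentially] (\<lambda>n. ln (real n) / lam)"
proof (rule asymp_equiv_by_relative_error)
  fix \<epsilon> :: real assume \<epsilon>: "0 < \<epsilon>"
  define \<delta> where "\<delta> = min (1/2) (\<epsilon> / 2)"
  have \<delta>: "0 < \<delta>" "\<delta> < 1" "\<delta> \<le> \<epsilon> / 2"
    using \<epsilon> by (auto simp: \<delta>_def)
  obtain A where A: "(1 + \<delta>) / lam \<le> A" "\<And>n. 1 \<le> n \<Longrightarrow> d n \<le> H A ((1 + \<delta>) / lam) n * m n"
    using d_le_H_sharp[OF \<delta>(1)] by blast
  have c: "0 \<le> (1 + \<delta>) / lam"
    using \<delta> lam_pos by simp
  have A0: "0 \<le> A"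
    using A(1) c by linarith
  obtain b where b: "eventually (\<lambda>n. (1 - \<delta>) / lam * ln (real n) - b \<le> rho n) sequentially"
    using rho_eventually_ge[of "(1 - \<delta>) / lam"] \<delta> lam_pos by auto
  define c where "c = (1 + \<delta>) / lam"
  define e where "e = \<delta> / lam"
  have e: "0 < e"
    using \<delta> lam_pos by (simp add: e_def)
  have "eventually (\<lambda>n::nat. A + c * (ln (real n + 1) - ln (real n)) \<le> e * ln (real n)) sequentially"
    using e by real_asymp
  moreover have "eventually (\<lambda>n::nat. b \<le> e * ln (real n)) sequentially"
    using e by real_asymp
  ultimately show "eventually (\<lambda>n. \<bar>rho n - ln (real n) / lam\<bar> \<le> \<epsilon> * \<bar>ln (real n) / lam\<bar>) sequentially"
    using b eventually_ge_at_top[of 1]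
  proof eventually_elim
    case (elim n)
    define L where "L = ln (real n) / lam"
    have L: "0 \<le> L"
      using elim(4) lam_pos by (simp add: L_def)
    have "rho n \<le> A + (1 + \<delta>) / lam * ln (real n + 1)"
      by (rule rho_le[OF A(2)[OF elim(4)] elim(4) c A0])
    also have "\<dots> \<le> (1 + 2 * \<delta>) * L"
      using elim(1) by (simp add: L_def c_def e_def add_divide_distrib algebra_simps)
    finally have 1: "rho n \<le> (1 + 2 * \<delta>) * L" .
    have 2: "(1 - 2 * \<delta>) * L \<le> rho n"
    proof -
      have "(1 - \<delta>) / lam * ln (real n) = (1 - \<delta>) * L" "e * ln (real n) = \<delta> * L"
        by (simp_all add: L_def e_def)
      then show ?thesis
        using elim(2,3) by (simp add: algebra_simps)
    qed
    have "2 * \<delta> * L \<le> \<epsilon> * L"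
      using \<delta> L by (intro mult_right_mono) auto
    then show ?case
      using 1 2 L by (simp add: abs_le_iff algebra_simps flip: L_def)
  qed
qed

end

section \<open>Asymptotics of the variance\<close>

context thinning
begin

text \<open>
  The logarithm of \<open>n\<close> to base \<open>\<kappa>\<close>.
\<close>

definition L :: "nat \<Rightarrow> real" where
  "L n = ln (real n) / lam"

text \<open>
  The claimed order of the variance, expressed through the mean instead of its Poisson transform.
\<close>

definition X :: "nat \<Rightarrow> real" where
  "X n = L n ^ 3 / (real n)\<^sup>2 * (m n)\<^sup>2"

text \<open>
  The common order of \<open>T n\<close> and of the increments of \<open>X\<close>.
\<close>

definition X_step :: "nat \<Rightarrow> real" where
  "X_step n = L n / real n * X n"

lemma L_centre: "(\<lambda>n. L (centre n)) \<sim>[sequentially] L"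
  unfolding L_def centre_def using q_pos lam_pos by real_asymp

lemma real_centre: "(\<lambda>n. real (centre n)) \<sim>[sequentially] (\<lambda>n. real n * q)"
  unfolding centre_def using q_pos by real_asymp

lemma d_asymp: "d \<sim>[sequentially] (\<lambda>n. L n * m n / real n)"
proof -
  have "(\<lambda>n. rho n * m n / real n) \<sim>[sequentially] (\<lambda>n. L n * m n / real n)"
    using rho_equiv unfolding L_def by (intro asymp_equiv_intros)
  moreover have "eventually (\<lambda>n. rho n * m n / real n = d n) sequentially"
    using eventually_ge_at_top[of 1] by eventually_elim (simp add: d_eq_rho)
  ultimately show ?thesis
    using asymp_equiv_cong[of "\<lambda>n. rho n * m n / real n" d sequentially
        "\<lambda>n. L n * m n / real n" "\<lambda>n. L n * m n / real n"] by simp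
qed

lemma m_centre: "(\<lambda>n. m (centre n)) \<sim>[sequentially] (\<lambda>n. L n * m n / real n)"
  using asymp_equiv_trans[OF asymp_equiv_symI[OF d_equiv] d_asymp] .

lemma eventually_L_pos: "eventually (\<lambda>n. 0 < L n) sequentially"
  unfolding L_def using lam_pos by real_asymp

text \<open>
  Each passage from \<open>q n\<close> to \<open>n\<close> costs a factor \<open>L n / n\<close>: \<open>m(q n) \<sim> d n \<sim> (L n / n) m n\<close>, and
  \<open>d(q n) \<sim> (L n / (q n)) m(q n)\<close>.
\<close>

lemma T_asymp: "T \<sim>[sequentially] (\<lambda>n. p / q * X_step n)"
proof -
  have "(\<lambda>n. d (centre n)) \<sim>[sequentially] (\<lambda>n. L (centre n) * m (centre n) / real (centre n))"
    by (rule asymp_equiv_compose'[OF d_asymp centre_at_top])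
  also have "\<dots> \<sim>[sequentially] (\<lambda>n. L n * (L n * m n / real n) / (real n * q))"
    by (intro asymp_equiv_intros L_centre m_centre real_centre)
  finally have "(\<lambda>n. real n * p * q * (d (centre n))\<^sup>2) \<sim>[sequentially]
      (\<lambda>n. real n * p * q * (L n * (L n * m n / real n) / (real n * q))\<^sup>2)"
    by (intro asymp_equiv_intros)
  also have "(\<lambda>n. real n * p * q * (L n * (L n * m n / real n) / (real n * q))\<^sup>2)
      = (\<lambda>n. p / q * X_step n)"
  proof
    fix n
    show "real n * p * q * (L n * (L n * m n / real n) / (real n * q))\<^sup>2 = p / q * X_step n"
      using q_pos by (cases "n = 0") (simp_all add: X_step_def X_def power2_eq_square power3_eq_cube field_simps)
  qed
  finally show ?thesis
    using asymp_equiv_trans[OF T_equiv] by blast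
qed

lemma X_nonneg: "0 \<le> X n"
  using lam_pos by (cases "n = 0") (simp_all add: X_def L_def)

lemma X_pos: "2 \<le> n \<Longrightarrow> 0 < X n"
  using lam_pos m_pos[of n] by (simp add: X_def L_def)

text \<open>
  The factor \<open>m\<^sup>2\<close> contributes the relative increment \<open>2 d / m\<close>; the remaining factor \<open>z\<close> has a
  relative increment of order \<open>1 / n\<close>, which is negligible against \<open>L n / n\<close>.
\<close>

lemma X_increment: "(\<lambda>n. X (Suc n) - X n) \<sim>[sequentially] (\<lambda>n. 2 * X_step n)"
proof -
  define z where "z n = L n ^ 3 / (real n)\<^sup>2" for n
  define h where "h n = d n / m n" for n
  define l where "l n = L n / real n" for n
  have h: "(\<lambda>n. h n / l n) \<longlonglongrightarrow> 1"
  proof -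
    have "(\<lambda>n. rho n / L n) \<longlonglongrightarrow> 1"
    proof (rule asymp_equivD_strong)
      show "rho \<sim>[sequentially] L"
        using rho_equiv by (simp add: L_def[abs_def])
      show "eventually (\<lambda>n. rho n \<noteq> 0 \<or> L n \<noteq> 0) sequentially"
        using eventually_L_pos by eventually_elim auto
    qed
    moreover have "eventually (\<lambda>n. rho n / L n = h n / l n) sequentially"
      using eventually_ge_at_top[of 1] by eventually_elim (simp add: rho_def h_def l_def mult_ac)
    ultimately show ?thesis
      by (rule Lim_transform_eventually)
  qed
  have l: "l \<longlonglongrightarrow> 0"
    unfolding l_def L_def using lam_pos by real_asymp
  have z: "(\<lambda>n. z (Suc n) / z n) \<longlonglongrightarrow> 1"
    unfolding z_def L_def using lam_pos by real_asymp
  have z': "(\<lambda>n. (z (Suc n) / z n - 1) / l n) \<longlonglongrightarrow> 0"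
  proof -
    \<comment> \<open>Over a common denominator, the cancellation of the leading terms becomes visible.\<close>
    define a where "a n = ln (real n + 1) ^ 3 * (real n)\<^sup>2" for n :: nat
    define b where "b n = ln (real n) ^ 3 * (real n + 1)\<^sup>2" for n :: nat
    have "(\<lambda>n. (a n - b n) / b n / (ln (real n) / real n)) \<longlonglongrightarrow> 0"
      unfolding a_def b_def by real_asymp
    then have "(\<lambda>n. lam * ((a n - b n) / b n / (ln (real n) / real n))) \<longlonglongrightarrow> 0"
      by (rule tendsto_mult_right_zero)
    moreover have "eventually (\<lambda>n. lam * ((a n - b n) / b n / (ln (real n) / real n))
        = (z (Suc n) / z n - 1) / l n) sequentially"
      using eventually_ge_at_top[of 2]
    proof eventually_elim
      case (elim n)
      have b: "b n \<noteq> 0"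
        using elim by (simp add: b_def)
      have "z (Suc n) / z n = a n / b n"
        using lam_pos by (simp add: z_def L_def a_def b_def power_divide add.commute)
      then have "z (Suc n) / z n - 1 = (a n - b n) / b n"
        using b by (simp add: diff_divide_distrib)
      then show ?case
        by (simp add: l_def L_def)
    qed
    ultimately show ?thesis
      by (rule Lim_transform_eventually)
  qed
  have pos: "eventually (\<lambda>n. 0 < l n \<and> 0 < z n \<and> 0 < m n) sequentially"
    using eventually_L_pos eventually_ge_at_top[of 1]
    by eventually_elim (simp add: l_def z_def m_pos)
  have "(\<lambda>n. (z (Suc n) / z n) * (2 * (h n / l n) + (h n / l n)\<^sup>2 * l n) + (z (Suc n) / z n - 1) / l n)
      \<longlonglongrightarrow> 1 * (2 * 1 + 1\<^sup>2 * 0) + 0"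
    by (intro tendsto_intros h l z z')
  moreover have "eventually (\<lambda>n. (z (Suc n) / z n) * (2 * (h n / l n) + (h n / l n)\<^sup>2 * l n) + (z (Suc n) / z n - 1) / l n
      = (X (Suc n) - X n) / (l n * X n)) sequentially"
    using pos
  proof eventually_elim
    case (elim n)
    have m: "m (Suc n) = m n * (1 + h n)"
      using elim by (simp add: h_def d_def field_simps)
    have X: "X n = z n * (m n)\<^sup>2" "X (Suc n) = z (Suc n) * (m n * (1 + h n))\<^sup>2"
      by (simp_all add: X_def z_def m)
    have "(X (Suc n) - X n) / (l n * X n) = ((z (Suc n) / z n) * (1 + h n)\<^sup>2 - 1) / l n"
    proof -
      have "X (Suc n) - X n = z n * (m n)\<^sup>2 * ((z (Suc n) / z n) * (1 + h n)\<^sup>2 - 1)"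
        unfolding X using elim by (simp add: power_mult_distrib right_diff_distrib)
      then show ?thesis
        using elim by (simp only:) (simp add: X)
    qed
    also have "\<dots> = (z (Suc n) / z n) * (2 * (h n / l n) + (h n / l n)\<^sup>2 * l n) + (z (Suc n) / z n - 1) / l n"
    proof -
      define t where "t = h n / l n"
      define r where "r = z (Suc n) / z n"
      have "h n = t * l n"
        using elim by (simp add: t_def)
      then have "r * (1 + h n)\<^sup>2 - 1 = l n * (r * (2 * t + t\<^sup>2 * l n)) + (r - 1)"
        by (simp add: power2_eq_square algebra_simps)
      then have "(r * (1 + h n)\<^sup>2 - 1) / l n = r * (2 * t + t\<^sup>2 * l n) + (r - 1) / l n"
        using elim by (simp only: add_divide_distrib) simp
      then show ?thesis
        by (simp only: t_def r_def)
    qed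
    finally show ?case
      by (rule sym)
  qed
  ultimately have "(\<lambda>n. (X (Suc n) - X n) / (l n * X n)) \<longlonglongrightarrow> 1 * (2 * 1 + 1\<^sup>2 * 0) + 0"
    by (rule Lim_transform_eventually)
  then have "(\<lambda>n. (X (Suc n) - X n) / (l n * X n) / 2) \<longlonglongrightarrow> 2 / 2"
    by (intro tendsto_intros) simp_all
  then have "(\<lambda>n. (X (Suc n) - X n) / (2 * (l n * X n))) \<longlonglongrightarrow> 1"
    by (simp add: mult.commute)
  then show ?thesis
    unfolding l_def X_step_def by (rule asymp_equivI')
qed

lemma eventually_step_pos: "eventually (\<lambda>n. 0 < X_step n) sequentially"
  using eventually_L_pos eventually_ge_at_top[of 2]
  by eventually_elim (simp add: X_step_def X_pos)

lemma X_step_ge: "eventually (\<lambda>n. X_step n \<le> X (Suc n) - X n) sequentially"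
proof -
  have "(\<lambda>n. (X (Suc n) - X n) / (2 * X_step n)) \<longlonglongrightarrow> 1"
    by (rule asymp_equivD_strong[OF X_increment]) (use eventually_step_pos in eventually_elim, auto)
  then have "eventually (\<lambda>n. 1 / 2 < (X (Suc n) - X n) / (2 * X_step n)) sequentially"
    by (rule order_tendstoD) simp
  then show ?thesis
    using eventually_step_pos by eventually_elim (simp add: less_divide_eq)
qed

text \<open>
  The relative increments of \<open>X\<close> are eventually at least \<open>1 / n\<close>, so \<open>X\<close> grows at least linearly.
\<close>

lemma X_at_top: "filterlim X at_top sequentially"
proof -
  have "eventually (\<lambda>n. 1 \<le> L n) sequentially"
    unfolding L_def using lam_pos by real_asymp
  then have "eventually (\<lambda>n. 2 \<le> n \<and> X n / real n \<le> X (Suc n) - X n) sequentially"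
    using X_step_ge eventually_ge_at_top[of 2]
  proof eventually_elim
    case (elim n)
    have "1 * X n / real n \<le> L n * X n / real n"
      using elim X_nonneg by (intro divide_right_mono mult_right_mono) auto
    then show ?case
      using elim by (simp add: X_step_def)
  qed
  then obtain N where N: "\<And>n. N \<le> n \<Longrightarrow> 2 \<le> n \<and> X n / real n \<le> X (Suc n) - X n"
    unfolding eventually_sequentially by blast
  have N2: "2 \<le> N"
    using N[of N] by simp
  have grow: "X N / real N * real n \<le> X n" if "N \<le> n" for n
    using that
  proof (induction n rule: dec_induct)
    case base
    then show ?case using N2 by simp
  next
    case (step n)
    have n: "0 < real n"
      using step N2 by simp
    have "X N / real N \<le> X n / real n"
      using step.IH n by (simp add: le_divide_eq)
    also have "\<dots> \<le> X (Suc n) - X n"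
      using N[OF step.hyps(1)] by simp
    finally have "X N / real N \<le> X (Suc n) - X n" .
    moreover have "X N / real N * real (Suc n) = X N / real N * real n + X N / real N"
      by (simp only: of_nat_Suc distrib_left mult_1_right add.commute)
    ultimately show ?case
      using step.IH by linarith
  qed
  have "0 < X N / real N"
    using X_pos[OF N2] N2 by simp
  then have "filterlim (\<lambda>n::nat. X N / real N * real n) at_top sequentially"
    by real_asymp
  then show ?thesis
    by (rule filterlim_at_top_mono) (use eventually_ge_at_top[of N] in eventually_elim, rule grow)
qed

lemma slow_X: "slow X"
proof -
  have "slow (\<lambda>n. L n ^ 3 / (real n)\<^sup>2)"
    unfolding slow_def
  proof
    show "eventually (\<lambda>n. 0 < L n ^ 3 / (real n)\<^sup>2) sequentially"
      unfolding L_def using lam_pos by real_asymp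
    show "(\<lambda>n. ln (L (Suc n) ^ 3 / (real (Suc n))\<^sup>2) - ln (L n ^ 3 / (real n)\<^sup>2)) \<in> O(\<lambda>n. real n powr (-4/5))"
      unfolding L_def using lam_pos by real_asymp
  qed
  then have "slow (\<lambda>n. L n ^ 3 / (real n)\<^sup>2 * (m n * m n))"
    by (intro slow_mult slow_m)
  then show ?thesis
    by (simp add: X_def[abs_def] power2_eq_square)
qed

text \<open>
  \<open>E X(B\<^sub>n)\<close> is close to \<open>X(q n)\<close>, which is smaller than \<open>X n\<close> by a factor of order \<open>(L n / n)\<^sup>2\<close>
  because \<open>m(q n) \<sim> (L n / n) m n\<close>.
\<close>

lemma avg_X_small: "(\<lambda>n. avg n X) \<in> o(\<lambda>n. X_step n)"
proof -
  have "(\<lambda>n. avg n X) \<sim>[sequentially] (\<lambda>n. X (centre n))"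
  proof (rule avg_slow[OF slow_X])
    show "eventually (\<lambda>n. 1 \<le> X n) sequentially"
      using X_at_top unfolding filterlim_at_top by blast
    have "eventually (\<lambda>n::nat. real n / lam ^ 3 \<le> (real n)\<^sup>2) sequentially"
      using lam_pos by real_asymp
    then show "eventually (\<lambda>n. \<forall>k\<le>n. \<bar>X k\<bar> \<le> (real n)\<^sup>2 * (m n)\<^sup>2) sequentially"
    proof eventually_elim
      case (elim n)
      show ?case
      proof (intro allI impI)
        fix k assume k: "k \<le> n"
        have "L k ^ 3 / (real k)\<^sup>2 \<le> (real n)\<^sup>2"
        proof (cases "k = 0")
          case False
          have "ln (real k) \<le> real k"
            using False ln_le_minus_one[of "real k"] by simp
          then have "L k ^ 3 \<le> (real k / lam) ^ 3"
            using False lam_pos by (intro power_mono) (auto simp: L_def divide_right_mono)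
          then have "L k ^ 3 / (real k)\<^sup>2 \<le> (real k / lam) ^ 3 / (real k)\<^sup>2"
            by (intro divide_right_mono) auto
          also have "\<dots> = real k / lam ^ 3"
            using False by (simp add: power_divide power2_eq_square power3_eq_cube)
          also have "\<dots> \<le> real n / lam ^ 3"
            using k lam_pos by (intro divide_right_mono) auto
          finally show ?thesis
            using elim by linarith
        qed simp
        then have "X k \<le> (real n)\<^sup>2 * (m n)\<^sup>2"
          unfolding X_def using m_nonneg mono_m[OF k] by (intro mult_mono power_mono) auto
        then show "\<bar>X k\<bar> \<le> (real n)\<^sup>2 * (m n)\<^sup>2"
          using X_nonneg by simp
      qed
    qed
  qed
  also have "(\<lambda>n. X (centre n)) \<sim>[sequentially]
      (\<lambda>n. L n ^ 3 / (real n * q)\<^sup>2 * (L n * m n / real n)\<^sup>2)"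
    unfolding X_def by (intro asymp_equiv_intros L_centre m_centre real_centre)
  finally have "(\<lambda>n. avg n X) \<in> O(\<lambda>n. L n ^ 3 / (real n * q)\<^sup>2 * (L n * m n / real n)\<^sup>2)"
    by (rule asymp_equiv_imp_bigo)
  also have "(\<lambda>n. L n ^ 3 / (real n * q)\<^sup>2 * (L n * m n / real n)\<^sup>2)
      = (\<lambda>n. (L n / (real n * q\<^sup>2)) * X_step n)"
  proof
    fix n
    show "L n ^ 3 / (real n * q)\<^sup>2 * (L n * m n / real n)\<^sup>2 = (L n / (real n * q\<^sup>2)) * X_step n"
      using q_pos by (cases "n = 0") (simp_all add: X_step_def X_def power2_eq_square field_simps)
  qed
  also have "\<dots> \<in> o(\<lambda>n. 1 * X_step n)"
  proof (rule landau_o.small.mult_right)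
    show "(\<lambda>n. L n / (real n * q\<^sup>2)) \<in> o(\<lambda>n. 1)"
      unfolding L_def using lam_pos q_pos by real_asymp
  qed
  finally show ?thesis by simp
qed

lemma X_increment_bigtheta: "(\<lambda>n. X (Suc n) - X n) \<in> \<Theta>(\<lambda>n. X_step n)"
proof -
  have "(\<lambda>n. X (Suc n) - X n) \<in> \<Theta>(\<lambda>n. 2 * X_step n)"
    by (rule asymp_equiv_imp_bigtheta[OF X_increment])
  then show ?thesis by simp
qed

lemma X_increment_pos: "eventually (\<lambda>n. X n < X (Suc n)) sequentially"
  using X_step_ge eventually_step_pos by eventually_elim simp

lemma T_over_X_increment: "(\<lambda>n. T n / (X (Suc n) - X n)) \<longlonglongrightarrow> p / (2 * q)"
proof -
  have "(\<lambda>n. T n / (X (Suc n) - X n)) \<sim>[sequentially]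
      (\<lambda>n. p / q * X_step n / (2 * X_step n))"
    by (intro asymp_equiv_intros T_asymp X_increment)
  moreover have "eventually (\<lambda>n. p / q * X_step n / (2 * X_step n) = p / (2 * q)) sequentially"
    using eventually_step_pos by eventually_elim (simp add: mult.commute)
  then have "(\<lambda>n. p / q * X_step n / (2 * X_step n)) \<longlonglongrightarrow> p / (2 * q)"
    by (rule tendsto_eventually)
  ultimately show ?thesis
    using tendsto_asymp_equiv_cong by blast
qed

lemma avg_X_over_X_increment: "(\<lambda>n. avg n X / (X (Suc n) - X n)) \<longlonglongrightarrow> 0"
proof -
  have "(\<lambda>n. avg n X) \<in> o(\<lambda>n. X (Suc n) - X n)"
    using avg_X_small landau_o.small.cong_bigtheta[OF X_increment_bigtheta] by blast
  then show ?thesis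
    by (rule smalloD_tendsto)
qed

lemma V_Suc: "1 \<le> n \<Longrightarrow> V (Suc n) = V n + avg n V + T n"
  using V_rec[of "n - 1"] by (cases n) auto

text \<open>
  Assuming \<open>V \<le> C X\<close> up to \<open>k\<close>, the recursive part of the next increment of \<open>V\<close> is at most
  \<open>C E X(B\<^sub>k)\<close>, hence at most half of \<open>C\<close> times the increment of \<open>X\<close>; the toll \<open>T k\<close> fits into the
  other half if \<open>C\<close> is large.
\<close>

lemma V_le_X:
  obtains C where "0 \<le> C" "\<And>n. V n \<le> C * X n"
proof -
  define c where "c = p / (2 * q) + 1"
  have "eventually (\<lambda>n. T n / (X (Suc n) - X n) < c) sequentially"
    by (rule order_tendstoD(2)[OF T_over_X_increment]) (simp add: c_def)
  moreover have "eventually (\<lambda>n. avg n X / (X (Suc n) - X n) < 1 / 2) sequentially"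
    by (rule order_tendstoD(2)[OF avg_X_over_X_increment]) simp
  ultimately have "eventually (\<lambda>n. 1 \<le> n \<and> T n \<le> c * (X (Suc n) - X n) \<and> avg n X \<le> 1 / 2 * (X (Suc n) - X n)) sequentially"
    using X_increment_pos eventually_ge_at_top[of 1]
  proof eventually_elim
    case (elim n)
    then show ?case
      by (simp add: divide_less_eq)
  qed
  then obtain N where N: "\<And>n. N \<le> n \<Longrightarrow> 1 \<le> n \<and> T n \<le> c * (X (Suc n) - X n) \<and> avg n X \<le> 1 / 2 * (X (Suc n) - X n)"
    unfolding eventually_sequentially by blast
  define C where "C = Max (insert (2 * c) ((\<lambda>n. V n / X n) ` {..N}))"
  have C: "2 * c \<le> C" "\<And>n. n \<le> N \<Longrightarrow> V n / X n \<le> C"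
    unfolding C_def by (intro Max_ge; simp)+
  have c: "0 < c"
    using p_pos q_pos by (simp add: c_def add_pos_pos)
  have C0: "0 \<le> C"
    using C(1) c by linarith
  have "V n \<le> C * X n" for n
  proof (induction n rule: less_induct)
    case (less n)
    consider "n < 2" | "2 \<le> n" "n \<le> N" | k where "n = Suc k" "N \<le> k"
      by (cases n) force+
    then show ?case
    proof cases
      case 1
      then have "V n = 0"
        using V_0 V_1 by (cases n) auto
      then show ?thesis
        using C0 X_nonneg by simp
    next
      case 2
      then show ?thesis
        using C(2)[of n] X_pos[of n] by (simp add: divide_le_eq)
    next
      case 3
      have k: "1 \<le> k" "T k \<le> c * (X (Suc k) - X k)" "avg k X \<le> 1 / 2 * (X (Suc k) - X k)"
        using N[OF 3(2)] by auto
      have "avg k V \<le> avg k (\<lambda>j. C * X j)"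
        using less 3 by (intro avg_mono) auto
      also have "\<dots> = C * avg k X"
        by (rule avg_cmult)
      also have "\<dots> \<le> C * (1 / 2 * (X (Suc k) - X k))"
        using k C0 by (intro mult_left_mono) auto
      finally have 1: "avg k V \<le> C / 2 * (X (Suc k) - X k)"
        by simp
      have pos: "0 \<le> X (Suc k) - X k"
        using k(3) avg_nonneg[of k X] X_nonneg by auto
      have 2: "T k \<le> C / 2 * (X (Suc k) - X k)"
        using k(2) mult_right_mono[of c "C / 2", OF _ pos] C(1) by auto
      have "V k \<le> C * X k"
        using less 3 by simp
      then have "V n \<le> C * X k + C * (X (Suc k) - X k)"
        using 1 2 V_Suc[OF k(1)] 3 by simp
      then show ?thesis
        by (simp add: 3 algebra_simps)
    qed
  qed
  then show thesis
    using that C0 by blast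
qed

theorem V_over_X: "(\<lambda>n. V n / X n) \<longlonglongrightarrow> p / (2 * q)"
proof (rule Stolz_Cesaro[OF X_at_top X_increment_pos])
  obtain C where C: "0 \<le> C" "\<And>n. V n \<le> C * X n"
    using V_le_X by blast
  have "(\<lambda>n. C * (avg n X / (X (Suc n) - X n))) \<longlonglongrightarrow> C * 0"
    by (intro tendsto_intros avg_X_over_X_increment)
  then have upper: "(\<lambda>n. C * (avg n X / (X (Suc n) - X n))) \<longlonglongrightarrow> 0"
    by simp
  have "(\<lambda>n. avg n V / (X (Suc n) - X n)) \<longlonglongrightarrow> 0"
  proof (rule tendsto_sandwich[OF _ _ tendsto_const upper])
    show "eventually (\<lambda>n. 0 \<le> avg n V / (X (Suc n) - X n)) sequentially"
      using X_increment_pos by eventually_elim (simp add: avg_nonneg V_nonneg)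
    show "eventually (\<lambda>n. avg n V / (X (Suc n) - X n) \<le> C * (avg n X / (X (Suc n) - X n))) sequentially"
      using X_increment_pos
    proof eventually_elim
      case (elim n)
      have "avg n V \<le> C * avg n X"
        using avg_mono[of n V "\<lambda>k. C * X k"] C(2) by (simp add: avg_cmult)
      then show ?case
        using elim by (simp add: divide_right_mono)
    qed
  qed
  then have "(\<lambda>n. avg n V / (X (Suc n) - X n) + T n / (X (Suc n) - X n)) \<longlonglongrightarrow> 0 + p / (2 * q)"
    by (intro tendsto_add T_over_X_increment)
  moreover have "eventually (\<lambda>n. avg n V / (X (Suc n) - X n) + T n / (X (Suc n) - X n)
      = (V (Suc n) - V n) / (X (Suc n) - X n)) sequentially"
    using eventually_ge_at_top[of 1] by eventually_elim (simp add: V_Suc add_divide_distrib)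
  ultimately have "(\<lambda>n. (V (Suc n) - V n) / (X (Suc n) - X n)) \<longlonglongrightarrow> 0 + p / (2 * q)"
    by (rule Lim_transform_eventually)
  then show "(\<lambda>n. (V (Suc n) - V n) / (X (Suc n) - X n)) \<longlonglongrightarrow> p / (2 * q)"
    by simp
qed

end

section \<open>The Poisson transform of the mean\<close>

lemma Poisson_sums: "(\<lambda>k. exp (- x) * (x ^ k / fact k) * y ^ k) sums exp (x * (y - 1))" for x y :: real
proof -
  have "(\<lambda>k. exp (- x) * ((x * y) ^ k /\<^sub>R fact k)) sums (exp (- x) * exp (x * y))"
    by (intro sums_mult exp_converges)
  moreover have "exp (- x) * exp (x * y) = exp (x * (y - 1))"
    by (simp add: algebra_simps flip: exp_add)
  ultimately show ?thesis
    by (simp add: power_mult_distrib divide_inverse mult_ac)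
qed

lemma Poisson_mean_sums: "(\<lambda>k. exp (- x) * (x ^ k / fact k) * real k) sums x" for x :: real
proof -
  have "(\<lambda>k. x * (exp (- x) * (x ^ k / fact k) * 1 ^ k)) sums (x * exp (x * (1 - 1)))"
    by (intro sums_mult Poisson_sums)
  moreover have "x * (exp (- x) * (x ^ k / fact k) * 1 ^ k)
      = exp (- x) * (x ^ Suc k / fact (Suc k)) * real (Suc k)" for k
    by (simp add: field_simps del: of_nat_Suc)
  moreover have "x * exp (x * (1 - 1)) = x"
    by simp
  ultimately have "(\<lambda>k. exp (- x) * (x ^ Suc k / fact (Suc k)) * real (Suc k)) sums x"
    by (simp only:)
  then show ?thesis
    by (subst (asm) sums_Suc_iff) simp
qed

context thinning
begin

lemma m_le_power: "m n \<le> 2 ^ n"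
proof (induction n)
  case (Suc n)
  show ?case
  proof (cases "n = 0")
    case False
    then have "m (Suc n) \<le> 2 * m n"
      using d_le_m[of n] by (simp add: d_def)
    then show ?thesis
      using Suc by simp
  qed (simp add: m_1)
qed (simp add: m_0)

lemma poisson_gf_sums: "0 \<le> x \<Longrightarrow> (\<lambda>k. exp (- x) * (x ^ k / fact k) * m k) sums poisson_gf p x"
proof -
  assume x: "0 \<le> x"
  have "summable (\<lambda>k. m k * x ^ k / fact k)"
  proof (rule summable_comparison_test')
    show "summable (\<lambda>k. (2 * x) ^ k /\<^sub>R fact k)"
      by (rule summable_exp_generic)
    show "norm (m k * x ^ k / fact k) \<le> (2 * x) ^ k /\<^sub>R fact k" for k
      using mult_right_mono[OF m_le_power[of k] zero_le_power[OF x]] m_nonneg[of k] x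
      by (simp add: power_mult_distrib divide_inverse mult.commute)
  qed
  then have "(\<lambda>k. exp (- x) * (m k * x ^ k / fact k)) sums (exp (- x) * (\<Sum>k. m k * x ^ k / fact k))"
    by (intro sums_mult summable_sums)
  then show ?thesis
    by (simp add: poisson_gf_def m_def mult_ac)
qed

text \<open>
  The mean is convex from \<open>1\<close> on. The point \<open>0\<close> violates convexity because \<open>d 0 = 1\<close>, but it lies
  above the tangent at \<open>n\<close> as soon as \<open>m n \<le> n d n\<close>.
\<close>

lemma m_tangent:
  assumes "1 \<le> n" "1 \<le> rho n"
  shows "m n + d n * (real k - real n) \<le> m k"
proof (cases "n \<le> k")
  case True
  then show ?thesis
  proof (induction k rule: dec_induct)
    case (step j)
    have "d n \<le> d j"
      using mono_d[OF assms(1)] step by simp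
    then show ?case
      using step by (simp add: d_def algebra_simps)
  qed simp
next
  case False
  then have k: "k \<le> n" by simp
  show ?thesis
  proof (cases "k = 0")
    case True
    have "m n \<le> real n * d n"
      using assms(2) m_pos[OF assms(1)] by (simp add: rho_def le_divide_eq)
    then show ?thesis
      by (simp add: True m_0 mult.commute)
  next
    case False
    from k False show ?thesis
    proof (induction k rule: inc_induct)
      case (step j)
      have "d j \<le> d n"
        using mono_d[of j n] step by simp
      then show ?case
        using step by (simp add: d_def algebra_simps)
    qed simp
  qed
qed

text \<open>
  Jensen's inequality: the Poisson law with mean \<open>n\<close> integrates the tangent of \<open>m\<close> at \<open>n\<close> to \<open>m n\<close>.
  The constant \<open>1\<close> is written as \<open>1 ^ k\<close> to match the generating function of the Poisson law.
\<close>

lemma m_le_poisson_gf: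
  assumes "1 \<le> n" "1 \<le> rho n"
  shows "m n \<le> poisson_gf p (real n)"
proof (rule sums_le)
  let ?P = "\<lambda>k. exp (- real n) * (real n ^ k / fact k)"
  show "?P k * (m n * 1 ^ k) + d n * (?P k * real k) - (d n * real n) * (?P k * 1 ^ k) \<le> ?P k * m k" for k
  proof -
    have "?P k * (m n + d n * (real k - real n)) \<le> ?P k * m k"
      by (intro mult_left_mono m_tangent assms) auto
    then show ?thesis
      by (simp add: algebra_simps add_divide_distrib)
  qed
  show "(\<lambda>k. ?P k * m k) sums poisson_gf p (real n)"
    by (rule poisson_gf_sums) simp
  have "(\<lambda>k. m n * (?P k * 1 ^ k) + d n * (?P k * real k) - (d n * real n) * (?P k * 1 ^ k)) sums
      (m n * exp (real n * (1 - 1)) + d n * real n - (d n * real n) * exp (real n * (1 - 1)))"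
    by (intro sums_add sums_diff sums_mult Poisson_sums Poisson_mean_sums)
  then show "(\<lambda>k. ?P k * (m n * 1 ^ k) + d n * (?P k * real k) - (d n * real n) * (?P k * 1 ^ k)) sums m n"
    by (simp add: mult_ac)
qed

lemma m_le_geometric:
  assumes "0 \<le> \<eta>" "n \<le> k" "\<And>j. n \<le> j \<Longrightarrow> d j \<le> \<eta> * m j"
  shows "m k \<le> m n * (1 + \<eta>) ^ (k - n)"
  using assms(2)
proof (induction k rule: dec_induct)
  case (step j)
  have "m (Suc j) \<le> m j * (1 + \<eta>)"
    using assms(3)[OF step.hyps(1)] by (simp add: d_def algebra_simps)
  also have "\<dots> \<le> m n * (1 + \<eta>) ^ (j - n) * (1 + \<eta>)"
    using step.IH assms(1) by (intro mult_right_mono) auto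
  finally show ?case
    using step.hyps by (simp add: Suc_diff_le mult_ac)
qed simp

text \<open>
  With \<open>x k = (1 + \<eta>)\<^bsup>k - n\<^esup>\<close> one has \<open>m k \<le> m n * max 1 (x k)\<close>, and \<open>max 1 x\<close> is at most
  \<open>1 + \<theta> + (x - 1)\<^sup>2 / \<theta>\<close>. The right-hand side is a combination of exponentials in \<open>k\<close>, whose Poisson
  expectations are explicit; the one of \<open>x k\<close> is at least \<open>1\<close>, so only the one of \<open>(x k)\<^sup>2\<close> remains in the
  bound.
\<close>

lemma poisson_gf_le:
  assumes \<eta>: "0 \<le> \<eta>" and \<theta>: "0 < \<theta>" and d: "\<And>j. n \<le> j \<Longrightarrow> d j \<le> \<eta> * m j"
  shows "poisson_gf p (real n) \<le> m n * (1 + \<theta> +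
     (exp (real n * ((1 + \<eta>)\<^sup>2 - 1)) / (1 + \<eta>) ^ (2 * n) - 1) / \<theta>)"
proof -
  let ?P = "\<lambda>k. exp (- real n) * (real n ^ k / fact k)"
  define y where "y = 1 + \<eta>"
  have y: "1 \<le> y"
    using \<eta> by (simp add: y_def)
  define x where "x k = y ^ k / y ^ n" for k
  have bound: "m k \<le> m n * (1 + \<theta> + (x k - 1)\<^sup>2 / \<theta>)" for k
  proof (cases "n \<le> k")
    case True
    have "x k = y ^ (k - n)"
      using True y by (simp add: x_def power_diff)
    then have "m k \<le> m n * x k"
      using m_le_geometric[OF \<eta> True d] by (simp add: y_def)
    also have "x k \<le> 1 + \<theta> + (x k - 1)\<^sup>2 / \<theta>"
    proof -
      have "0 \<le> (x k - 1 - \<theta>)\<^sup>2 + (x k - 1)\<^sup>2 + \<theta>\<^sup>2"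
        by simp
      then have "(x k - 1) * \<theta> \<le> \<theta>\<^sup>2 + (x k - 1)\<^sup>2"
        by (simp add: power2_eq_square algebra_simps)
      then have "x k - 1 \<le> (\<theta>\<^sup>2 + (x k - 1)\<^sup>2) / \<theta>"
        using \<theta> by (simp add: le_divide_eq)
      then show ?thesis
        using \<theta> by (simp add: add_divide_distrib power2_eq_square)
    qed
    finally show ?thesis
      using m_nonneg by (simp add: mult_left_mono)
  next
    case False
    have "m k * 1 \<le> m n * (1 + \<theta> + (x k - 1)\<^sup>2 / \<theta>)"
      using False m_nonneg \<theta> mono_m[of k n] by (intro mult_mono) auto
    then show ?thesis by simp
  qed
  define E1 where "E1 = exp (real n * (y - 1)) / y ^ n"
  define E2 where "E2 = exp (real n * (y\<^sup>2 - 1)) / y ^ (2 * n)"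
  have "poisson_gf p (real n) \<le> m n * (1 + \<theta>) + m n / \<theta> * (E2 - 2 * E1 + 1)"
  proof (rule sums_le)
    show "(\<lambda>k. ?P k * m k) sums poisson_gf p (real n)"
      by (rule poisson_gf_sums) simp
    show "?P k * m k \<le> m n * (1 + \<theta>) * (?P k * 1 ^ k)
        + m n / \<theta> * (?P k * (y\<^sup>2) ^ k / y ^ (2 * n) - 2 * (?P k * y ^ k / y ^ n) + ?P k * 1 ^ k)" for k
    proof -
      define c where "c = ?P k"
      define a where "a = (y\<^sup>2) ^ k / y ^ (2 * n)"
      define b where "b = y ^ k / y ^ n"
      have x2: "(x k - 1)\<^sup>2 = a - 2 * b + 1"
        by (simp add: x_def a_def b_def power2_diff power_divide power_mult mult.commute flip: power_mult)
      have "c * m k \<le> c * (m n * (1 + \<theta> + (a - 2 * b + 1) / \<theta>))"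
        using bound[of k] unfolding x2 by (intro mult_left_mono) (simp_all add: c_def)
      also have "\<dots> = m n * (1 + \<theta>) * c + m n / \<theta> * (c * a - 2 * (c * b) + c)"
        by (simp add: add_divide_distrib diff_divide_distrib algebra_simps)
      finally show ?thesis
        by (simp only: a_def b_def c_def times_divide_eq_right power_one mult_1_right)
    qed
    have "(\<lambda>k. m n * (1 + \<theta>) * (?P k * 1 ^ k)
        + m n / \<theta> * (?P k * (y\<^sup>2) ^ k / y ^ (2 * n) - 2 * (?P k * y ^ k / y ^ n) + ?P k * 1 ^ k)) sums
        (m n * (1 + \<theta>) * exp (real n * (1 - 1)) + m n / \<theta> * (E2 - 2 * E1 + exp (real n * (1 - 1))))"
      unfolding E1_def E2_def by (intro sums_add sums_diff sums_mult sums_divide Poisson_sums)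
    then show "(\<lambda>k. m n * (1 + \<theta>) * (?P k * 1 ^ k)
        + m n / \<theta> * (?P k * (y\<^sup>2) ^ k / y ^ (2 * n) - 2 * (?P k * y ^ k / y ^ n) + ?P k * 1 ^ k)) sums
        (m n * (1 + \<theta>) + m n / \<theta> * (E2 - 2 * E1 + 1))"
      by simp
  qed
  also have "\<dots> \<le> m n * (1 + \<theta>) + m n / \<theta> * (E2 - 1)"
  proof -
    have "y ^ n \<le> exp (real n * (y - 1))"
    proof -
      have "y \<le> exp (y - 1)"
        using exp_ge_add_one_self[of "y - 1"] by simp
      then have "y ^ n \<le> exp (y - 1) ^ n"
        using y by (intro power_mono) auto
      then show ?thesis
        by (simp add: exp_of_nat_mult)
    qed
    then have "1 \<le> E1"
      using y by (simp add: E1_def le_divide_eq)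
    then show ?thesis
      using m_nonneg \<theta> by (intro add_left_mono mult_left_mono) auto
  qed
  also have "\<dots> = m n * (1 + \<theta> + (E2 - 1) / \<theta>)"
    by (simp add: distrib_left)
  finally show ?thesis
    by (simp only: E2_def y_def)
qed

text \<open>
  With \<open>\<eta> = H A c n\<close>, of order \<open>(ln n) / n\<close>, the Poisson expectation of \<open>(x k)\<^sup>2\<close> in \<open>poisson_gf_le\<close> is
  \<open>exp (O(n \<eta>\<^sup>2))\<close> and tends to \<open>1\<close>.
\<close>

theorem poisson_gf_equiv: "(\<lambda>n. poisson_gf p (real n)) \<sim>[sequentially] m"
proof (rule asymp_equiv_by_relative_error)
  fix \<epsilon> :: real assume \<epsilon>: "0 < \<epsilon>"
  obtain A where A: "4 / lam \<le> A" "\<And>n. 1 \<le> n \<Longrightarrow> d n \<le> H A (4 / lam) n * m n"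
    using d_le_H_crude by blast
  define c where "c = 4 / lam"
  have c: "0 < c" "0 < A" "c \<le> A"
    using lam_pos A(1) by (auto simp: c_def intro: less_le_trans[of 0 "4 / lam"])
  define \<theta> where "\<theta> = \<epsilon> / 2"
  have \<theta>: "0 < \<theta>"
    using \<epsilon> by (simp add: \<theta>_def)
  have "(\<lambda>n. exp (real n * ((1 + H A c n)\<^sup>2 - 1)) / (1 + H A c n) ^ (2 * n)) \<longlonglongrightarrow> 1"
    unfolding H_def using c by real_asymp
  then have "eventually (\<lambda>n. exp (real n * ((1 + H A c n)\<^sup>2 - 1)) / (1 + H A c n) ^ (2 * n) < 1 + \<theta>\<^sup>2) sequentially"
    by (rule order_tendstoD) (use \<theta> in simp)
  moreover have "eventually (\<lambda>n. 1 \<le> rho n) sequentially"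
    using rho_at_top unfolding filterlim_at_top by blast
  ultimately show "eventually (\<lambda>n. \<bar>poisson_gf p (real n) - m n\<bar> \<le> \<epsilon> * \<bar>m n\<bar>) sequentially"
    using eventually_ge_at_top[of 1]
  proof eventually_elim
    case (elim n)
    define E where "E = exp (real n * ((1 + H A c n)\<^sup>2 - 1)) / (1 + H A c n) ^ (2 * n)"
    have "d j \<le> H A c n * m j" if "n \<le> j" for j
    proof -
      have "d j \<le> H A c j * m j"
        using A(2)[of j] elim that by (simp add: c_def)
      also have "\<dots> \<le> H A c n * m j"
        using c that by (intro mult_right_mono H_antimono m_nonneg) auto
      finally show ?thesis .
    qed
    moreover have "0 \<le> H A c n"
      using c by (simp add: H_def)
    ultimately have "poisson_gf p (real n) \<le> m n * (1 + \<theta> + (E - 1) / \<theta>)"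
      unfolding E_def by (intro poisson_gf_le \<theta>)
    also have "\<dots> \<le> m n * (1 + \<epsilon>)"
    proof (intro mult_left_mono m_nonneg)
      have "(E - 1) / \<theta> \<le> \<theta>"
        using elim(1) \<theta> by (simp add: E_def divide_le_eq power2_eq_square)
      moreover have "\<theta> + \<theta> = \<epsilon>"
        by (simp add: \<theta>_def)
      ultimately show "1 + \<theta> + (E - 1) / \<theta> \<le> 1 + \<epsilon>"
        by linarith
    qed
    finally have "poisson_gf p (real n) \<le> m n * (1 + \<epsilon>)" .
    then show ?case
      using m_le_poisson_gf[OF elim(3,2)] m_nonneg[of n] by (simp add: algebra_simps abs_le_iff)
  qed
qed

end

theorem theorem4p3:
  fixes p q \<kappa> C\<^sub>\<sigma> :: real
  assumes "0 < p" and "p < 1"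
    and "q = 1 - p"
    and "\<kappa> = 1 / q"
    and "C\<^sub>\<sigma> = p / (2 * q)"
  shows "(\<lambda>n::nat. variance_Y p n) \<sim>[sequentially]
           (\<lambda>n::nat. C\<^sub>\<sigma> / (real n)\<^sup>2 * (log \<kappa> (real n)) ^ 3 * (poisson_gf p (real n))\<^sup>2)"
proof -
  interpret thinning p q
    using assms by unfold_locales auto
  have C: "C\<^sub>\<sigma> \<noteq> 0"
    using p_pos q_pos assms(5) by simp
  have L: "log \<kappa> (real n) = L n" for n
    using q_pos by (simp add: L_def lam_def log_def assms(4) ln_div)
  have "(\<lambda>n. V n / X n / C\<^sub>\<sigma>) \<longlonglongrightarrow> C\<^sub>\<sigma> / C\<^sub>\<sigma>"
    using V_over_X C unfolding assms(5)[symmetric] by (intro tendsto_intros)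
  then have "(\<lambda>n. V n / (C\<^sub>\<sigma> * X n)) \<longlonglongrightarrow> 1"
    using C by (simp add: mult.commute)
  then have "V \<sim>[sequentially] (\<lambda>n. C\<^sub>\<sigma> * X n)"
    by (rule asymp_equivI')
  also have "(\<lambda>n. C\<^sub>\<sigma> * X n) = (\<lambda>n. C\<^sub>\<sigma> / (real n)\<^sup>2 * L n ^ 3 * (m n)\<^sup>2)"
    by (simp add: X_def fun_eq_iff)
  also have "\<dots> \<sim>[sequentially] (\<lambda>n. C\<^sub>\<sigma> / (real n)\<^sup>2 * L n ^ 3 * (poisson_gf p (real n))\<^sup>2)"
    by (intro asymp_equiv_intros asymp_equiv_symI[OF poisson_gf_equiv])
  finally show ?thesis
    by (simp add: L V_def)
qed

end
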